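(* Let $m_1<m_2<m_3$ be positive integers with $\gcd\{m_1,m_2,m_3\}=1$ (so $n=3$). Then $K[\mathcal{C}]$ is a Koszul algebra if and only if $\{m_1,m_2,m_3\}$ is $\{1,2,3\}$, $\{1,2,4\}$ or $\{2,3,4\}$.
   Context: $K$ is an infinite field and $R=K[x_1,\ldots,x_{n+1}]$ with its standard grading, here with $n=3$. For positive integers $m_1<\cdots<m_n$, the associated projective monomial curve $\mathcal{C}\subset\mathbb{P}^n_K$ is parametrically defined by $x_i=u^{m_i}v^{m_n-m_i}$ for $1\le i\le n$ and $x_{n+1}=v^{m_n}$. Its vanishing ideal $I(\mathcal{C})\subset R$ is the kernel of the $K$-algebra homomorphism $R\to K[u,v]$, $x_i\mapsto u^{m_i}v^{m_n-m_i}$ ($1\le i\le n$), $x_{n+1}\mapsto v^{m_n}$, and $K[\mathcal{C}]=R/I(\mathcal{C})$. $K[\mathcal{C}]$ is a Koszul algebra if its residue class field $K$ has a linear free resolution as a $K[\mathcal{C}]$-module. *)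

theory Defs
  imports
    "HOL-Algebra.Module"
    "HOL-Algebra.QuotRing"
    "HOL-Library.FuncSet"
    "HOL-Library.Poly_Mapping"
begin

section \<open>Polynomial rings\<close>

text \<open>Monomials are finitely supported exponent vectors, and polynomials are finitely supported
  families of coefficients; the multiplication is the convolution product of
  \<^theory>\<open>HOL-Library.Poly_Mapping\<close>.\<close>

type_synonym 'k mpoly = "(nat \<Rightarrow>\<^sub>0 nat) \<Rightarrow>\<^sub>0 'k"

definition mvar :: "nat \<Rightarrow> 'k::field mpoly"
  where "mvar i = Poly_Mapping.single (Poly_Mapping.single i 1) 1"

definition mconst :: "'k \<Rightarrow> 'k::field mpoly"
  where "mconst c = Poly_Mapping.single 0 c"

definition mpoly_ring :: "nat set \<Rightarrow> 'k::field mpoly ring"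
  where "mpoly_ring X =
    \<lparr>carrier = {p. \<forall>a\<in>Poly_Mapping.keys p. Poly_Mapping.keys a \<subseteq> X},
     monoid.mult = (*), one = 1, zero = 0, add = (+)\<rparr>"

definition mdeg :: "(nat \<Rightarrow>\<^sub>0 nat) \<Rightarrow> nat"
  where "mdeg a = (\<Sum>i\<in>Poly_Mapping.keys a. Poly_Mapping.lookup a i)"

definition mpoly_grading :: "nat set \<Rightarrow> nat \<Rightarrow> 'k::field mpoly set"
  where "mpoly_grading X d =
    {p \<in> carrier (mpoly_ring X). \<forall>a\<in>Poly_Mapping.keys p. mdeg a = d}"

text \<open>The \<open>K\<close>-algebra homomorphism sending the variable with index \<open>i\<close> to \<open>f i\<close>.\<close>

definition mpoly_subst :: "(nat \<Rightarrow> 'k mpoly) \<Rightarrow> 'k mpoly \<Rightarrow> 'k::field mpoly"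
  where "mpoly_subst f p =
    (\<Sum>a\<in>Poly_Mapping.keys p. mconst (Poly_Mapping.lookup p a) *
       (\<Prod>i\<in>Poly_Mapping.keys a. f i ^ Poly_Mapping.lookup a i))"


section \<open>Graded rings and linear free resolutions\<close>

text \<open>A grading is the family of its homogeneous components. The quotient \<open>A Quot J\<close> is graded by
  the images of the components of \<open>A\<close> (this is a grading if \<open>J\<close> is a homogeneous ideal).\<close>

definition quot_grading :: "('a, 'm) ring_scheme \<Rightarrow> (nat \<Rightarrow> 'a set) \<Rightarrow> 'a set \<Rightarrow> nat \<Rightarrow> 'a set set"
  where "quot_grading A G J d = (\<lambda>a. J +>\<^bsub>A\<^esub> a) ` G d"

definition irrelevant_ideal :: "('a, 'm) ring_scheme \<Rightarrow> (nat \<Rightarrow> 'a set) \<Rightarrow> 'a set"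
  where "irrelevant_ideal A G = Idl\<^bsub>A\<^esub> (\<Union>d\<in>{1..}. G d)"

text \<open>In module records only \<open>carrier\<close>, \<open>zero\<close>, \<open>add\<close> and \<open>smult\<close> are meaningful; the fields
  \<open>mult\<close> and \<open>one\<close> are inherited from \<^type>\<open>ring\<close> and never used for modules.\<close>

definition quot_module :: "('a, 'm) ring_scheme \<Rightarrow> 'a set \<Rightarrow> ('a, 'a set) module"
  where "quot_module A J =
    \<lparr>carrier = carrier (A Quot J),
     monoid.mult = monoid.mult (A Quot J), one = \<one>\<^bsub>A Quot J\<^esub>,
     zero = \<zero>\<^bsub>A Quot J\<^esub>, add = add (A Quot J),
     smult = (\<lambda>a x. (J +>\<^bsub>A\<^esub> a) \<otimes>\<^bsub>A Quot J\<^esub> x)\<rparr>"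

definition free_module :: "('a, 'm) ring_scheme \<Rightarrow> nat \<Rightarrow> ('a, nat \<Rightarrow> 'a) module"
  where "free_module A b =
    \<lparr>carrier = {..<b} \<rightarrow>\<^sub>E carrier A,
     monoid.mult = undefined, one = undefined,
     zero = (\<lambda>j\<in>{..<b}. \<zero>\<^bsub>A\<^esub>), add = (\<lambda>x y. \<lambda>j\<in>{..<b}. x j \<oplus>\<^bsub>A\<^esub> y j),
     smult = (\<lambda>a x. \<lambda>j\<in>{..<b}. a \<otimes>\<^bsub>A\<^esub> x j)\<rparr>"

text \<open>The grading of the free module \<open>A(-s)\<^sup>b\<close>: its component of degree \<open>d\<close> is
  \<open>(A\<^bsub>d-s\<^esub>)\<^sup>b\<close>, which is \<open>0\<close> for \<open>d < s\<close>.\<close>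

definition free_grading ::
    "('a, 'm) ring_scheme \<Rightarrow> (nat \<Rightarrow> 'a set) \<Rightarrow> nat \<Rightarrow> nat \<Rightarrow> nat \<Rightarrow> (nat \<Rightarrow> 'a) set"
  where "free_grading A G s b d = {..<b} \<rightarrow>\<^sub>E (if s \<le> d then G (d - s) else {\<zero>\<^bsub>A\<^esub>})"

definition module_homs ::
    "('a, 'm) ring_scheme \<Rightarrow> ('a, 'b, 'p) module_scheme \<Rightarrow> ('a, 'c, 'q) module_scheme \<Rightarrow> ('b \<Rightarrow> 'c) set"
  where "module_homs A M N =
    {f \<in> hom (add_monoid M) (add_monoid N).
       \<forall>a\<in>carrier A. \<forall>x\<in>carrier M. f (a \<odot>\<^bsub>M\<^esub> x) = a \<odot>\<^bsub>N\<^esub> f x}"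

definition graded_module_homs ::
    "('a, 'm) ring_scheme \<Rightarrow> ('a, 'b, 'p) module_scheme \<Rightarrow> (nat \<Rightarrow> 'b set) \<Rightarrow>
     ('a, 'c, 'q) module_scheme \<Rightarrow> (nat \<Rightarrow> 'c set) \<Rightarrow> ('b \<Rightarrow> 'c) set"
  where "graded_module_homs A M G N H = {f \<in> module_homs A M N. \<forall>d. f ` G d \<subseteq> H d}"

text \<open>A linear free resolution of a graded module \<open>M\<close> over a graded ring \<open>A\<close> is an exact sequence
  \<open>\<dots> \<rightarrow> A(-2)\<^sup>b\<^sup>2 \<rightarrow> A(-1)\<^sup>b\<^sup>1 \<rightarrow> A\<^sup>b\<^sup>0 \<rightarrow> M \<rightarrow> 0\<close>, possibly infinite to the left, with homomorphisms
  preserving degrees. Equivalently, the matrices of the maps \<open>\<phi> i\<close> have entries of degree one.\<close>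

definition linear_free_resolution ::
    "('a, 'm) ring_scheme \<Rightarrow> (nat \<Rightarrow> 'a set) \<Rightarrow> ('a, 'b, 'p) module_scheme \<Rightarrow> (nat \<Rightarrow> 'b set) \<Rightarrow>
     (nat \<Rightarrow> nat) \<Rightarrow> (nat \<Rightarrow> (nat \<Rightarrow> 'a) \<Rightarrow> (nat \<Rightarrow> 'a)) \<Rightarrow> ((nat \<Rightarrow> 'a) \<Rightarrow> 'b) \<Rightarrow> bool"
  where "linear_free_resolution A G M H b \<phi> \<epsilon> \<longleftrightarrow>
    \<epsilon> \<in> graded_module_homs A (free_module A (b 0)) (free_grading A G 0 (b 0)) M H \<and>
    (\<forall>i. \<phi> i \<in> graded_module_homs A
       (free_module A (b (Suc i))) (free_grading A G (Suc i) (b (Suc i)))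
       (free_module A (b i)) (free_grading A G i (b i))) \<and>
    \<epsilon> ` carrier (free_module A (b 0)) = carrier M \<and>
    \<phi> 0 ` carrier (free_module A (b 1)) = a_kernel (free_module A (b 0)) M \<epsilon> \<and>
    (\<forall>i. \<phi> (Suc i) ` carrier (free_module A (b (Suc (Suc i)))) =
       a_kernel (free_module A (b (Suc i))) (free_module A (b i)) (\<phi> i))"

definition has_linear_free_resolution ::
    "('a, 'm) ring_scheme \<Rightarrow> (nat \<Rightarrow> 'a set) \<Rightarrow> ('a, 'b, 'p) module_scheme \<Rightarrow> (nat \<Rightarrow> 'b set) \<Rightarrow> bool"
  where "has_linear_free_resolution A G M H \<longleftrightarrow>
    (\<exists>b \<phi> \<epsilon>. linear_free_resolution A G M H b \<phi> \<epsilon>)"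

text \<open>The residue class field of the standard graded \<open>K\<close>-algebra \<open>A\<close> is its quotient by the
  irrelevant ideal, viewed as a graded \<open>A\<close>-module (concentrated in degree zero).\<close>

definition koszul :: "('a, 'm) ring_scheme \<Rightarrow> (nat \<Rightarrow> 'a set) \<Rightarrow> bool"
  where "koszul A G \<longleftrightarrow>
    has_linear_free_resolution A G
      (quot_module A (irrelevant_ideal A G)) (quot_grading A G (irrelevant_ideal A G))"


section \<open>Projective monomial curves\<close>

text \<open>The variables \<open>u\<close> and \<open>v\<close> of \<open>K[u,v]\<close> carry the indices 0 and 1, the variables of
  \<open>R = K[x\<^sub>1, \<dots>, x\<^bsub>n+1\<^esub>]\<close> the indices \<open>1, \<dots>, n + 1\<close>.\<close>

definition curve_param :: "nat \<Rightarrow> (nat \<Rightarrow> nat) \<Rightarrow> nat \<Rightarrow> 'k::field mpoly"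
  where "curve_param n m i =
    (if i \<le> n then mvar 0 ^ m i * mvar 1 ^ (m n - m i) else mvar 1 ^ m n)"

definition curve_ideal :: "nat \<Rightarrow> (nat \<Rightarrow> nat) \<Rightarrow> 'k::field mpoly set"
  where "curve_ideal n m =
    a_kernel (mpoly_ring {1..n+1}) (mpoly_ring {0, 1}) (mpoly_subst (curve_param n m))"

definition curve_ring :: "nat \<Rightarrow> (nat \<Rightarrow> nat) \<Rightarrow> 'k::field mpoly set ring"
  where "curve_ring n m = mpoly_ring {1..n+1} Quot curve_ideal n m"

definition curve_grading :: "nat \<Rightarrow> (nat \<Rightarrow> nat) \<Rightarrow> nat \<Rightarrow> 'k::field mpoly set set"
  where "curve_grading n m =
    quot_grading (mpoly_ring {1..n+1}) (mpoly_grading {1..n+1}) (curve_ideal n m)"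

end

theory Submission
  imports Defs "HOL-Library.Product_Plus"
begin

text \<open>Recording the degree and the exponent of \<open>u\<close> identifies \<open>K[\<C>]\<close> with the monoid algebra
  \<open>K[S]\<close> of the monoid \<open>S \<subseteq> \<nat>\<^sup>2\<close> generated by \<open>(1, i)\<close> for
  \<open>i \<in> {0, m\<^sub>1, m\<^sub>2, m\<^sub>3}\<close>.

  If \<open>K[S]\<close> is Koszul, then \<open>I(\<C>)\<close> is generated by quadrics. The relations
  \<open>m\<^sub>2 \<sqdot> m\<^sub>1 = m\<^sub>1 \<sqdot> m\<^sub>2 + (m\<^sub>2 - m\<^sub>1) \<sqdot> 0\<close> and \<open>m\<^sub>3 \<sqdot> m\<^sub>2 = m\<^sub>2 \<sqdot> m\<^sub>3 + (m\<^sub>3 - m\<^sub>2) \<sqdot> 0\<close>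
  must therefore be reachable by quadratic ones starting from a pure power, so
  \<open>2m\<^sub>1 \<in> {m\<^sub>2, m\<^sub>3}\<close> and \<open>2m\<^sub>2 \<in> {m\<^sub>3, m\<^sub>1 + m\<^sub>3}\<close>, which leaves the three given sets.

  Conversely, each of these three monoid algebras has a Koszul filtration by ideals generated by
  variables, and iterating syzygies along it yields a linear resolution of \<open>K\<close>.\<close>

section \<open>Transport along graded ring isomorphisms\<close>

text \<open>For necessity nothing is known about the given resolution except that it is linear: its
  ranks and matrices are arbitrary and no minimal resolution is constructed for comparison. The
  proof therefore works with its first two matrices as they are. If 2p decomposes only as p + p, a
  K-linear functional made from coefficients of their entries kills all combinations of linear
  syzygies but takes the value 1 on a binomial syzygy of higher degree. It can be evaluated because
  unique decompositions in the monoid make coefficients of products multiplicative. For sufficiency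
  all colon ideals are monomial, so they can be compared exponent by exponent, independently of
  \<open>K\<close>; what remains is linear arithmetic in two coordinates. The conditions on 2m_1 and
  2m_2 leave three families, each determined up to a common factor, which the gcd sets to 1. The
  sets {1,2,4} and {2,3,4} are mirror images under exchanging u and v, and {1,2,3} is the twisted
  cubic.\<close>

definition semilinear_iso ::
    "('a, 'm) ring_scheme \<Rightarrow> ('c, 'n) ring_scheme \<Rightarrow> ('a \<Rightarrow> 'c) \<Rightarrow>
     ('a, 'b, 'p) module_scheme \<Rightarrow> ('c, 'd, 'q) module_scheme \<Rightarrow> ('b \<Rightarrow> 'd) \<Rightarrow> ('d \<Rightarrow> 'b) \<Rightarrow> bool"
  where "semilinear_iso A B h M N f g \<longleftrightarrow>
    bij_betw f (carrier M) (carrier N) \<and>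
    (\<forall>x\<in>carrier M. g (f x) = x) \<and>
    (\<forall>x\<in>carrier M. \<forall>y\<in>carrier M. x \<oplus>\<^bsub>M\<^esub> y \<in> carrier M \<and> f (x \<oplus>\<^bsub>M\<^esub> y) = f x \<oplus>\<^bsub>N\<^esub> f y) \<and>
    (\<forall>a\<in>carrier A. \<forall>x\<in>carrier M. a \<odot>\<^bsub>M\<^esub> x \<in> carrier M \<and> f (a \<odot>\<^bsub>M\<^esub> x) = h a \<odot>\<^bsub>N\<^esub> f x) \<and>
    \<zero>\<^bsub>M\<^esub> \<in> carrier M \<and> f \<zero>\<^bsub>M\<^esub> = \<zero>\<^bsub>N\<^esub>"

lemma graded_module_homs_funcset:
  "\<phi> \<in> graded_module_homs A M G N H \<Longrightarrow> \<phi> \<in> carrier M \<rightarrow> carrier N"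
  by (auto simp: graded_module_homs_def module_homs_def hom_def)

text \<open>Every element of \<open>N\<close> is some \<open>f x\<close> and \<open>g\<close> undoes
  \<open>f\<close>, so each law for the conjugate \<open>f' \<circ> \<phi> \<circ> g\<close> reduces
  to the law for \<open>\<phi>\<close>; surjectivity of \<open>h\<close> does the same for scalars.
  Source and target have different rings of scalars, hence the semilinearity over
  \<open>h\<close>.\<close>

lemma semilinear_iso_graded_homs:
  assumes h: "h ` carrier A = carrier B"
    and f: "semilinear_iso A B h M N f g" and f': "semilinear_iso A B h M' N' f' g'"
    and fG: "\<And>d. G d \<subseteq> carrier M" "\<And>d. f ` G d = H d" "\<And>d. f' ` G' d = H' d"
    and \<phi>: "\<phi> \<in> graded_module_homs A M G M' G'"
  shows "f' \<circ> \<phi> \<circ> g \<in> graded_module_homs B N H N' H'"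
proof -
  have N: "carrier N = f ` carrier M" "carrier N' = f' ` carrier M'"
    using f f' by (auto simp: semilinear_iso_def bij_betw_def)
  have gf: "g (f x) = x" if "x \<in> carrier M" for x
    using f that by (auto simp: semilinear_iso_def)
  have \<phi>c: "\<phi> x \<in> carrier M'" if "x \<in> carrier M" for x
    using \<phi> that by (auto simp: graded_module_homs_def module_homs_def hom_def)
  have add: "f x \<oplus>\<^bsub>N\<^esub> f y = f (x \<oplus>\<^bsub>M\<^esub> y)" "x \<oplus>\<^bsub>M\<^esub> y \<in> carrier M"
    if "x \<in> carrier M" "y \<in> carrier M" for x y
    using f that by (auto simp: semilinear_iso_def)
  have smult: "h a \<odot>\<^bsub>N\<^esub> f x = f (a \<odot>\<^bsub>M\<^esub> x)" "a \<odot>\<^bsub>M\<^esub> x \<in> carrier M"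
    if "a \<in> carrier A" "x \<in> carrier M" for a x
    using f that by (auto simp: semilinear_iso_def)
  have add': "f' (x \<oplus>\<^bsub>M'\<^esub> y) = f' x \<oplus>\<^bsub>N'\<^esub> f' y" if "x \<in> carrier M'" "y \<in> carrier M'" for x y
    using f' that by (auto simp: semilinear_iso_def)
  have smult': "f' (a \<odot>\<^bsub>M'\<^esub> x) = h a \<odot>\<^bsub>N'\<^esub> f' x" if "a \<in> carrier A" "x \<in> carrier M'" for a x
    using f' that by (auto simp: semilinear_iso_def)
  have \<phi>add: "\<phi> (x \<oplus>\<^bsub>M\<^esub> y) = \<phi> x \<oplus>\<^bsub>M'\<^esub> \<phi> y" if "x \<in> carrier M" "y \<in> carrier M" for x y
    using \<phi> that by (auto simp: graded_module_homs_def module_homs_def hom_def)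
  have \<phi>smult: "\<phi> (a \<odot>\<^bsub>M\<^esub> x) = a \<odot>\<^bsub>M'\<^esub> \<phi> x" if "a \<in> carrier A" "x \<in> carrier M" for a x
    using \<phi> that by (auto simp: graded_module_homs_def module_homs_def hom_def)
  have gr: "\<phi> x \<in> G' d" if "x \<in> G d" for x d
    using \<phi> that by (auto simp: graded_module_homs_def)
  have "(f' \<circ> \<phi> \<circ> g) ` H d \<subseteq> H' d" for d
    using fG(1)[of d] fG(2)[of d, symmetric] fG(3)[of d, symmetric] gr gf by auto
  moreover have "f' \<circ> \<phi> \<circ> g \<in> module_homs B N N'"
    unfolding module_homs_def hom_def
    by (auto simp: N h[symmetric] gf \<phi>c add smult add' smult' \<phi>add \<phi>smult)
  ultimately show ?thesis
    by (simp add: graded_module_homs_def)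
qed

lemma semilinear_iso_kernel:
  assumes f: "semilinear_iso A B h M N f g" and f': "semilinear_iso A B h M' N' f' g'"
    and \<phi>: "\<phi> \<in> carrier M \<rightarrow> carrier M'"
  shows "a_kernel N N' (f' \<circ> \<phi> \<circ> g) = f ` a_kernel M M' \<phi>"
proof -
  have N: "carrier N = f ` carrier M"
    using f by (auto simp: semilinear_iso_def bij_betw_def)
  have gf: "g (f x) = x" if "x \<in> carrier M" for x
    using f that by (auto simp: semilinear_iso_def)
  have inj: "inj_on f' (carrier M')" and z: "\<zero>\<^bsub>M'\<^esub> \<in> carrier M'" "f' \<zero>\<^bsub>M'\<^esub> = \<zero>\<^bsub>N'\<^esub>"
    using f' by (auto simp: semilinear_iso_def bij_betw_def)
  have "f' (\<phi> x) = \<zero>\<^bsub>N'\<^esub> \<longleftrightarrow> \<phi> x = \<zero>\<^bsub>M'\<^esub>" if "x \<in> carrier M" for x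
    using inj funcset_mem[OF \<phi> that] z by (metis inj_onD)
  then show ?thesis
    by (auto simp: a_kernel_def' N gf z)
qed

lemma semilinear_iso_image:
  assumes f: "semilinear_iso A B h M N f g"
  shows "(f' \<circ> \<phi> \<circ> g) ` carrier N = f' ` \<phi> ` carrier M"
proof -
  have N: "carrier N = f ` carrier M" and "\<And>x. x \<in> carrier M \<Longrightarrow> g (f x) = x"
    using f by (auto simp: semilinear_iso_def bij_betw_def)
  then have "g ` carrier N = carrier M"
    by (simp add: image_image)
  then show ?thesis
    by (metis image_comp)
qed

text \<open>The ranks stay the same and every map is conjugated. Exactness survives because
  \<open>f\<close> carries images to images and kernels to kernels.\<close>

lemma linear_free_resolution_transport:
  assumes h: "h ` carrier A = carrier B"
    and F: "\<And>b. semilinear_iso A B h (free_module A b) (free_module B b) (f b) (g b)"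
    and FG: "\<And>s b d. f b ` free_grading A G s b d = free_grading B H s b d"
    and FC: "\<And>s b d. free_grading A G s b d \<subseteq> carrier (free_module A b)"
    and M: "semilinear_iso A B h M N f' g'" "\<And>d. f' ` G' d = H' d"
    and res: "linear_free_resolution A G M G' b \<phi> \<epsilon>"
  shows "linear_free_resolution B H N H' b
    (\<lambda>i. f (b i) \<circ> \<phi> i \<circ> g (b (Suc i))) (f' \<circ> \<epsilon> \<circ> g (b 0))"
proof -
  note r = res[unfolded linear_free_resolution_def]
  have e1: "f' \<circ> \<epsilon> \<circ> g (b 0) \<in> graded_module_homs B (free_module B (b 0)) (free_grading B H 0 (b 0)) N H'"
    using r by (intro semilinear_iso_graded_homs[OF h F M(1) FC FG M(2)]) auto
  have e2: "f (b i) \<circ> \<phi> i \<circ> g (b (Suc i)) \<in> graded_module_homs B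
       (free_module B (b (Suc i))) (free_grading B H (Suc i) (b (Suc i)))
       (free_module B (b i)) (free_grading B H i (b i))" for i
    using r by (intro semilinear_iso_graded_homs[OF h F F FC FG FG]) auto
  have e3: "(f' \<circ> \<epsilon> \<circ> g (b 0)) ` carrier (free_module B (b 0)) = carrier N"
    using r M(1) by (simp only: semilinear_iso_image[OF F]) (auto simp: semilinear_iso_def bij_betw_def)
  have "\<epsilon> \<in> carrier (free_module A (b 0)) \<rightarrow> carrier M"
    using r by (intro graded_module_homs_funcset) auto
  then have e4: "(f (b 0) \<circ> \<phi> 0 \<circ> g (b (Suc 0))) ` carrier (free_module B (b (Suc 0)))
      = a_kernel (free_module B (b 0)) N (f' \<circ> \<epsilon> \<circ> g (b 0))"
    using r by (simp add: semilinear_iso_image[OF F] semilinear_iso_kernel[OF F M(1)] del: o_apply)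
  have "\<phi> i \<in> carrier (free_module A (b (Suc i))) \<rightarrow> carrier (free_module A (b i))" for i
    using r by (intro graded_module_homs_funcset) auto
  then have e5: "(f (b (Suc i)) \<circ> \<phi> (Suc i) \<circ> g (b (Suc (Suc i)))) ` carrier (free_module B (b (Suc (Suc i))))
      = a_kernel (free_module B (b (Suc i))) (free_module B (b i)) (f (b i) \<circ> \<phi> i \<circ> g (b (Suc i)))" for i
    using r by (simp add: semilinear_iso_image[OF F] semilinear_iso_kernel[OF F F] del: o_apply)
  show ?thesis
    unfolding linear_free_resolution_def using e1 e2 e3 e4 e5 by simp
qed

lemma semilinear_iso_free_module:
  assumes A: "ring A" and B: "ring B" and h: "h \<in> ring_iso A B"
  shows "semilinear_iso A B h (free_module A b) (free_module B b)
    (\<lambda>x. \<lambda>j\<in>{..<b}. h (x j)) (\<lambda>y. \<lambda>j\<in>{..<b}. inv_into (carrier A) h (y j))"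
proof -
  interpret A: ring A by fact
  interpret B: ring B by fact
  note hE = ring_iso_memE[OF h]
  have bij: "inj_on h (carrier A)" "h ` carrier A = carrier B"
    using hE(5) by (auto simp: bij_betw_def)
  have h0: "h \<zero>\<^bsub>A\<^esub> = \<zero>\<^bsub>B\<^esub>"
    using ring_hom_zero[OF _ A B] h by (auto simp: ring_iso_def)
  have inv: "(\<lambda>j\<in>{..<b}. inv_into (carrier A) h ((\<lambda>j\<in>{..<b}. h (x j)) j)) = x"
    "(\<lambda>j\<in>{..<b}. h (x j)) \<in> {..<b} \<rightarrow>\<^sub>E carrier B"
    if "x \<in> {..<b} \<rightarrow>\<^sub>E carrier A" for x
  proof -
    have "x j \<in> carrier A" if "j < b" for j
      using \<open>x \<in> _\<close> that by auto
    then show "(\<lambda>j\<in>{..<b}. inv_into (carrier A) h ((\<lambda>j\<in>{..<b}. h (x j)) j)) = x"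
      "(\<lambda>j\<in>{..<b}. h (x j)) \<in> {..<b} \<rightarrow>\<^sub>E carrier B"
      using that bij hE(1) by (auto simp: fun_eq_iff PiE_iff extensional_def)
  qed
  have inv': "(\<lambda>j\<in>{..<b}. h ((\<lambda>j\<in>{..<b}. inv_into (carrier A) h (y j)) j)) = y"
    "(\<lambda>j\<in>{..<b}. inv_into (carrier A) h (y j)) \<in> {..<b} \<rightarrow>\<^sub>E carrier A"
    if "y \<in> {..<b} \<rightarrow>\<^sub>E carrier B" for y
  proof -
    have "y j \<in> h ` carrier A" if "j < b" for j
      using \<open>y \<in> _\<close> that bij by auto
    then show "(\<lambda>j\<in>{..<b}. h ((\<lambda>j\<in>{..<b}. inv_into (carrier A) h (y j)) j)) = y"
      "(\<lambda>j\<in>{..<b}. inv_into (carrier A) h (y j)) \<in> {..<b} \<rightarrow>\<^sub>E carrier A"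
      using that by (auto simp: fun_eq_iff PiE_def extensional_def Pi_def f_inv_into_f inv_into_into)
  qed
  have "bij_betw (\<lambda>x. \<lambda>j\<in>{..<b}. h (x j)) ({..<b} \<rightarrow>\<^sub>E carrier A) ({..<b} \<rightarrow>\<^sub>E carrier B)"
    by (rule bij_betwI[where g = "\<lambda>y. \<lambda>j\<in>{..<b}. inv_into (carrier A) h (y j)"])
      (intro funcsetI inv inv'; assumption)+
  moreover have "x j \<in> carrier A" if "x \<in> {..<b} \<rightarrow>\<^sub>E carrier A" "j < b" for x j
    using that by auto
  ultimately show ?thesis
    unfolding semilinear_iso_def free_module_def
    using inv(1) by (auto simp: hE h0 fun_eq_iff)
qed

lemma image_free_grading:
  assumes "h \<zero>\<^bsub>A\<^esub> = \<zero>\<^bsub>B\<^esub>" and "\<And>d. h ` G d = H d"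
  shows "(\<lambda>x. \<lambda>j\<in>{..<b}. h (x j)) ` free_grading A G s b d = free_grading B H s b d"
proof -
  have "(\<lambda>x. \<lambda>j\<in>{..<b}. h (x j)) ` ({..<b} \<rightarrow>\<^sub>E X) = {..<b} \<rightarrow>\<^sub>E h ` X" for X
  proof (intro equalityI subsetI)
    fix y assume y: "y \<in> {..<b} \<rightarrow>\<^sub>E h ` X"
    have "\<forall>j\<in>{..<b}. \<exists>x\<in>X. h x = y j"
    proof
      fix j assume "j \<in> {..<b}"
      with y have "y j \<in> h ` X" by (auto simp: PiE_iff)
      then show "\<exists>x\<in>X. h x = y j" by auto
    qed
    then obtain x where "\<forall>j\<in>{..<b}. x j \<in> X \<and> h (x j) = y j"
      by metis
    with y have "restrict x {..<b} \<in> {..<b} \<rightarrow>\<^sub>E X" "y = (\<lambda>j\<in>{..<b}. h (restrict x {..<b} j))"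
      by (auto simp: fun_eq_iff PiE_iff extensional_def)
    then show "y \<in> (\<lambda>x. \<lambda>j\<in>{..<b}. h (x j)) ` ({..<b} \<rightarrow>\<^sub>E X)"
      by blast
  qed (auto simp: PiE_iff)
  then show ?thesis
    using assms by (simp add: free_grading_def)
qed

lemma ring_hom_image_genideal:
  assumes "ring A" and "ring B" and "h \<in> ring_hom A B" and U: "U \<subseteq> carrier A"
  shows "h ` (Idl\<^bsub>A\<^esub> U) \<subseteq> Idl\<^bsub>B\<^esub> (h ` U)"
proof -
  interpret A: ring A by fact
  interpret B: ring B by fact
  interpret h: ring_hom_ring A B h
    by (rule ring_hom_ringI2) fact+
  have UB: "h ` U \<subseteq> carrier B"
    using U by auto
  have "ideal {r \<in> carrier A. h r \<in> Idl\<^bsub>B\<^esub> (h ` U)} A"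
    using B.genideal_ideal[OF UB] by (rule h.ideal_vimage)
  then have "Idl\<^bsub>A\<^esub> U \<subseteq> {r \<in> carrier A. h r \<in> Idl\<^bsub>B\<^esub> (h ` U)}"
    using U B.genideal_self[OF UB] by (intro A.genideal_minimal) auto
  then show ?thesis
    by auto
qed

text \<open>The inclusion for homomorphisms, applied to \<open>h\<close> and to its inverse.\<close>

lemma ring_iso_image_genideal:
  assumes A: "ring A" and B: "ring B" and h: "h \<in> ring_iso A B" and U: "U \<subseteq> carrier A"
  shows "h ` (Idl\<^bsub>A\<^esub> U) = Idl\<^bsub>B\<^esub> (h ` U)"
proof
  let ?k = "inv_into (carrier A) h"
  have inj: "inj_on h (carrier A)" and im: "h ` carrier A = carrier B"
    using ring_iso_memE(5)[OF h] by (auto simp: bij_betw_def)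
  have hom: "h \<in> ring_hom A B" "?k \<in> ring_hom B A"
    using h ring_iso_set_sym[OF A h] by (auto simp: ring_iso_def)
  show "h ` (Idl\<^bsub>A\<^esub> U) \<subseteq> Idl\<^bsub>B\<^esub> (h ` U)"
    by (rule ring_hom_image_genideal[OF A B hom(1) U])
  have UB: "h ` U \<subseteq> carrier B"
    using U im by auto
  have sub: "Idl\<^bsub>B\<^esub> (h ` U) \<subseteq> h ` carrier A"
    using ideal.Icarr[OF ring.genideal_ideal[OF B UB]] im by auto
  have "?k ` (Idl\<^bsub>B\<^esub> (h ` U)) \<subseteq> Idl\<^bsub>A\<^esub> U"
    using ring_hom_image_genideal[OF B A hom(2) UB] inj U by (simp add: inv_into_image_cancel)
  then have "h ` ?k ` (Idl\<^bsub>B\<^esub> (h ` U)) \<subseteq> h ` (Idl\<^bsub>A\<^esub> U)"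
    by (rule image_mono)
  then show "Idl\<^bsub>B\<^esub> (h ` U) \<subseteq> h ` (Idl\<^bsub>A\<^esub> U)"
    using sub by (simp add: image_inv_into_cancel[OF refl])
qed

text \<open>Elements of a factor ring are cosets, hence sets, so the induced map takes images under
  \<open>h\<close>.\<close>

lemma semilinear_iso_quot_module:
  assumes "ring A" and "ring B" and h: "h \<in> ring_iso A B" and I: "ideal I A" and J: "ideal J B" "h ` I = J"
  shows "semilinear_iso A B h (quot_module A I) (quot_module B J) ((`) h) ((`) (inv_into (carrier A) h))"
    and "\<And>a. a \<in> carrier A \<Longrightarrow> h ` (I +>\<^bsub>A\<^esub> a) = J +>\<^bsub>B\<^esub> h a"
proof -
  interpret A: ring A by fact
  interpret B: ring B by fact
  interpret I: ideal I A by fact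
  interpret J: ideal J B by fact
  note hE = ring_iso_memE[OF h]
  have inj: "inj_on h (carrier A)" and im: "h ` carrier A = carrier B"
    using hE(5) by (auto simp: bij_betw_def)
  show c: "h ` (I +>\<^bsub>A\<^esub> a) = J +>\<^bsub>B\<^esub> h a" if "a \<in> carrier A" for a
    using that hE(3) I.a_subset by (auto simp: a_r_coset_def' J(2)[symmetric] image_iff subset_iff; metis)
  have QA: "carrier (A Quot I) = (\<lambda>a. I +>\<^bsub>A\<^esub> a) ` carrier A"
    by (auto simp: FactRing_def A_RCOSETS_def')
  have QB: "carrier (B Quot J) = (\<lambda>a. J +>\<^bsub>B\<^esub> a) ` carrier B"
    by (auto simp: FactRing_def A_RCOSETS_def')
  have sub: "X \<subseteq> carrier A" if "X \<in> carrier (A Quot I)" for X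
    using that I.a_subset by (auto simp: QA a_r_coset_def')
  have inv: "inv_into (carrier A) h ` h ` X = X" if "X \<in> carrier (A Quot I)" for X
    using sub[OF that] inj by (simp add: inv_into_image_cancel)
  have img: "(`) h ` carrier (A Quot I) = carrier (B Quot J)"
    by (auto simp: QA QB c im[symmetric] image_image)
  have "bij_betw ((`) h) (carrier (A Quot I)) (carrier (B Quot J))"
    unfolding bij_betw_def using img by (auto intro!: inj_on_inverseI[where g = "(`) (inv_into (carrier A) h)"] inv)
  moreover have "X \<oplus>\<^bsub>A Quot I\<^esub> Y \<in> carrier (A Quot I) \<and> h ` (X \<oplus>\<^bsub>A Quot I\<^esub> Y) = h ` X \<oplus>\<^bsub>B Quot J\<^esub> h ` Y"
    if "X \<in> carrier (A Quot I)" "Y \<in> carrier (A Quot I)" for X Y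
  proof -
    obtain x y where x: "x \<in> carrier A" "X = I +>\<^bsub>A\<^esub> x" and y: "y \<in> carrier A" "Y = I +>\<^bsub>A\<^esub> y"
      using \<open>X \<in> _\<close> \<open>Y \<in> _\<close> by (auto simp: QA)
    have "X \<oplus>\<^bsub>A Quot I\<^esub> Y = I +>\<^bsub>A\<^esub> (x \<oplus>\<^bsub>A\<^esub> y)" "h ` X \<oplus>\<^bsub>B Quot J\<^esub> h ` Y = J +>\<^bsub>B\<^esub> (h x \<oplus>\<^bsub>B\<^esub> h y)"
      using x y hE(1) by (simp_all add: c FactRing_def I.a_rcos_sum J.a_rcos_sum)
    then show ?thesis
      using x y hE(3) by (simp add: QA c)
  qed
  moreover have "(I +>\<^bsub>A\<^esub> a) \<otimes>\<^bsub>A Quot I\<^esub> X \<in> carrier (A Quot I) \<and>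
    h ` ((I +>\<^bsub>A\<^esub> a) \<otimes>\<^bsub>A Quot I\<^esub> X) = (J +>\<^bsub>B\<^esub> h a) \<otimes>\<^bsub>B Quot J\<^esub> h ` X"
    if a: "a \<in> carrier A" and "X \<in> carrier (A Quot I)" for a X
  proof -
    obtain x where x: "x \<in> carrier A" "X = I +>\<^bsub>A\<^esub> x"
      using \<open>X \<in> _\<close> by (auto simp: QA)
    have "(I +>\<^bsub>A\<^esub> a) \<otimes>\<^bsub>A Quot I\<^esub> X = I +>\<^bsub>A\<^esub> (a \<otimes>\<^bsub>A\<^esub> x)"
      "(J +>\<^bsub>B\<^esub> h a) \<otimes>\<^bsub>B Quot J\<^esub> h ` X = J +>\<^bsub>B\<^esub> (h a \<otimes>\<^bsub>B\<^esub> h x)"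
      using a x hE(1) by (simp_all add: c FactRing_def I.rcoset_mult_add J.rcoset_mult_add)
    then show ?thesis
      using a x hE(2) by (simp add: QA c)
  qed
  moreover have "\<zero>\<^bsub>A Quot I\<^esub> \<in> carrier (A Quot I)"
    using ring.ring_simprules(2)[OF I.quotient_is_ring] .
  ultimately show "semilinear_iso A B h (quot_module A I) (quot_module B J) ((`) h) ((`) (inv_into (carrier A) h))"
    unfolding semilinear_iso_def quot_module_def using inv J(2) by (auto simp: FactRing_def)
qed

text \<open>The irrelevant ideal is generated by the components of positive degree, so a graded
  isomorphism carries it over, and with it the residue field and its resolution. This allows the
  curve ring, whose elements are cosets, to be replaced by a monoid algebra.\<close>

lemma koszul_ring_iso:
  assumes A: "ring A" and B: "ring B" and h: "h \<in> ring_iso A B"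
    and G: "\<And>d. G d \<subseteq> carrier A" "\<And>d. h ` G d = H d"
    and "koszul A G"
  shows "koszul B H"
proof -
  interpret A: ring A by fact
  interpret B: ring B by fact
  have im: "h ` carrier A = carrier B"
    using ring_iso_memE(5)[OF h] by (auto simp: bij_betw_def)
  have h0: "h \<zero>\<^bsub>A\<^esub> = \<zero>\<^bsub>B\<^esub>"
    using ring_hom_zero[OF _ A B] h by (auto simp: ring_iso_def)
  have U: "(\<Union>d\<in>{1..}. G d) \<subseteq> carrier A" "(\<Union>d\<in>{1..}. H d) \<subseteq> carrier B"
    using G im by (fast, fastforce)
  have hU: "h ` (\<Union>d\<in>{1..}. G d) = (\<Union>d\<in>{1..}. H d)"
    by (simp add: image_UN G)
  have I: "ideal (irrelevant_ideal A G) A" "ideal (irrelevant_ideal B H) B"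
    using A.genideal_ideal B.genideal_ideal U by (simp_all add: irrelevant_ideal_def)
  have hI: "h ` irrelevant_ideal A G = irrelevant_ideal B H"
    unfolding irrelevant_ideal_def using ring_iso_image_genideal[OF A B h U(1)] hU by simp
  note Q = semilinear_iso_quot_module[OF A B h I hI]
  have QG: "(`) h ` quot_grading A G (irrelevant_ideal A G) d = quot_grading B H (irrelevant_ideal B H) d" for d
    unfolding quot_grading_def G(2)[of d, symmetric] image_image
    using G(1)[of d] by (intro image_cong refl Q(2)) auto
  have FC: "free_grading A G s b d \<subseteq> carrier (free_module A b)" for s b d
    using G(1)[of "d - s"] unfolding free_grading_def free_module_def by (simp add: PiE_mono)
  obtain b \<phi> \<epsilon> where "linear_free_resolution A G (quot_module A (irrelevant_ideal A G))
      (quot_grading A G (irrelevant_ideal A G)) b \<phi> \<epsilon>"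
    using \<open>koszul A G\<close> by (auto simp: koszul_def has_linear_free_resolution_def)
  from linear_free_resolution_transport[OF im semilinear_iso_free_module[OF A B h]
      image_free_grading[OF h0 G(2)] FC Q(1) QG this]
  show ?thesis
    by (auto simp: koszul_def has_linear_free_resolution_def)
qed

section \<open>Koszul filtrations\<close>

text \<open>Ring records over subsets of a type-class ring: the operations are those of the class,
  so its simplification rules and finite sums apply directly.\<close>

definition subset_ring :: "'a::comm_ring_1 set \<Rightarrow> 'a ring"
  where "subset_ring B = \<lparr>carrier = B, monoid.mult = (*), one = 1, zero = 0, add = (+)\<rparr>"

lemma subset_ring_simps [simp]:
  "carrier (subset_ring B) = B" "x \<otimes>\<^bsub>subset_ring B\<^esub> y = x * y" "\<one>\<^bsub>subset_ring B\<^esub> = 1"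
  "\<zero>\<^bsub>subset_ring B\<^esub> = 0" "x \<oplus>\<^bsub>subset_ring B\<^esub> y = x + y"
  by (simp_all add: subset_ring_def)

locale comm_subring =
  fixes B :: "'a::comm_ring_1 set"
  assumes one_closed: "1 \<in> B"
    and uminus_closed: "x \<in> B \<Longrightarrow> - x \<in> B"
    and add_closed: "x \<in> B \<Longrightarrow> y \<in> B \<Longrightarrow> x + y \<in> B"
    and mult_closed: "x \<in> B \<Longrightarrow> y \<in> B \<Longrightarrow> x * y \<in> B"
begin

lemma zero_closed: "0 \<in> B"
  using add_closed[OF one_closed uminus_closed[OF one_closed]] by simp

lemma diff_closed: "x \<in> B \<Longrightarrow> y \<in> B \<Longrightarrow> x - y \<in> B"
  using add_closed[OF _ uminus_closed] by fastforce

lemma sum_closed: "(\<And>i. i \<in> I \<Longrightarrow> f i \<in> B) \<Longrightarrow> sum f I \<in> B"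
  by (induction I rule: infinite_finite_induct) (auto intro: add_closed zero_closed)

lemma cring_subset_ring: "cring (subset_ring B)"
proof (rule cringI)
  show "abelian_group (subset_ring B)"
  proof (rule abelian_groupI)
    fix x assume "x \<in> carrier (subset_ring B)"
    then show "\<exists>y\<in>carrier (subset_ring B). y \<oplus>\<^bsub>subset_ring B\<^esub> x = \<zero>\<^bsub>subset_ring B\<^esub>"
      by (auto intro!: bexI[of _ "- x"] uminus_closed)
  qed (auto simp: zero_closed algebra_simps intro: add_closed)
  show "Group.comm_monoid (subset_ring B)"
    by (rule Group.comm_monoidI) (auto simp: one_closed algebra_simps intro: mult_closed)
qed (auto simp: algebra_simps)

end

text \<open>The grading comes with its projections \<open>proj d\<close>. The decisive law is
  \<open>proj_mult\<close>: in a relation between homogeneous elements it lets the coefficients be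
  replaced by their parts of a single degree.\<close>

locale graded_subring = comm_subring B for B :: "'a::comm_ring_1 set" +
  fixes G :: "nat \<Rightarrow> 'a set" and proj :: "nat \<Rightarrow> 'a \<Rightarrow> 'a"
  assumes G_subset: "G d \<subseteq> B"
    and G_one: "1 \<in> G 0"
    and G_uminus: "x \<in> G d \<Longrightarrow> - x \<in> G d"
    and G_add: "x \<in> G d \<Longrightarrow> y \<in> G d \<Longrightarrow> x + y \<in> G d"
    and G_mult: "x \<in> G d \<Longrightarrow> y \<in> G e \<Longrightarrow> x * y \<in> G (d + e)"
    and proj_G: "x \<in> B \<Longrightarrow> proj d x \<in> G d"
    and proj_id: "x \<in> G d \<Longrightarrow> proj d x = x"
    and proj_add: "proj d (x + y) = proj d x + proj d y"
    and proj_mult: "x \<in> B \<Longrightarrow> y \<in> G e \<Longrightarrow> proj (d + e) (x * y) = proj d x * y"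
begin

lemma G_closed: "x \<in> G d \<Longrightarrow> x \<in> B"
  using G_subset by auto

lemma proj_zero: "proj d 0 = 0"
  using proj_add[of d 0 0] by simp

lemma G_zero: "0 \<in> G d"
  using proj_G[OF zero_closed, of d] by (simp add: proj_zero)

lemma G_sum: "(\<And>i. i \<in> I \<Longrightarrow> f i \<in> G d) \<Longrightarrow> sum f I \<in> G d"
  by (induction I rule: infinite_finite_induct) (auto intro: G_add G_zero)

lemma proj_sum: "proj d (sum f I) = (\<Sum>i\<in>I. proj d (f i))"
  by (induction I rule: infinite_finite_induct) (auto simp: proj_zero proj_add)

definition lspan :: "'a list \<Rightarrow> 'a set"
  where "lspan L = {f. \<exists>c. (\<forall>i<length L. c i \<in> B) \<and> f = (\<Sum>i<length L. c i * L ! i)}"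

text \<open>Membership in the submodule of \<open>B^b\<close> generated by
  \<open>g 0, ..., g (n - 1)\<close>. Vectors are plain functions compared below \<open>b\<close>
  only, so their other values need no convention.\<close>

definition vspan :: "nat \<Rightarrow> nat \<Rightarrow> (nat \<Rightarrow> nat \<Rightarrow> 'a) \<Rightarrow> (nat \<Rightarrow> 'a) \<Rightarrow> bool"
  where "vspan b n g v \<longleftrightarrow> (\<exists>c. (\<forall>i<n. c i \<in> B) \<and> (\<forall>j<b. v j = (\<Sum>i<n. c i * g i j)))"

text \<open>A Koszul filtration with ordered generators: a list of linear forms records a chain of
  ideals with cyclic quotients. Only the colon ideals along the chain have to be generated by lists
  of \<open>F\<close>; the ideals of the prefixes may lie outside.\<close>

definition koszul_filtration :: "'a list set \<Rightarrow> bool"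
  where "koszul_filtration F \<longleftrightarrow> (\<forall>L\<in>F. \<forall>s<length L. L ! s \<in> G 1 \<and>
    (\<exists>L'\<in>F. \<forall>f\<in>B. f * L ! s \<in> lspan (take s L) \<longleftrightarrow> f \<in> lspan L'))"

text \<open>The invariant of the iteration: a property of the \<open>n\<close> rows, each of length
  \<open>b\<close>, of a matrix that is inherited by a matrix of generating syzygies.\<close>

definition linear_quotients :: "'a list set \<Rightarrow> nat \<Rightarrow> nat \<Rightarrow> (nat \<Rightarrow> nat \<Rightarrow> 'a) \<Rightarrow> bool"
  where "linear_quotients F b n g \<longleftrightarrow> (\<forall>k<n. (\<forall>j<b. g k j \<in> G 1) \<and>
    (\<exists>L\<in>F. \<forall>f\<in>B. vspan b k g (\<lambda>j. f * g k j) \<longleftrightarrow> f \<in> lspan L))"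

definition syzygies :: "nat \<Rightarrow> nat \<Rightarrow> (nat \<Rightarrow> nat \<Rightarrow> 'a) \<Rightarrow> nat \<Rightarrow> (nat \<Rightarrow> nat \<Rightarrow> 'a) \<Rightarrow> bool"
  where "syzygies b n g n' g' \<longleftrightarrow> (\<forall>z. (\<forall>k<n. z k \<in> B) \<longrightarrow>
    ((\<forall>j<b. (\<Sum>k<n. z k * g k j) = 0) \<longleftrightarrow> vspan n n' g' z))"

lemma vspan_generator: "l < n \<Longrightarrow> vspan b n g (g l)"
  unfolding vspan_def
  by (rule exI[of _ "\<lambda>i. if i = l then 1 else 0"])
    (auto simp: if_distrib[of "\<lambda>x. x * _"] sum.delta one_closed zero_closed cong: if_cong)

lemma lspan_generator: "s < length L \<Longrightarrow> L ! s \<in> lspan L"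
  unfolding lspan_def
  by (rule CollectI, rule exI[of _ "\<lambda>i. if i = s then 1 else 0"])
    (auto simp: if_distrib[of "\<lambda>x. x * _"] sum.delta one_closed zero_closed cong: if_cong)

lemma sum_lessThan_add: "sum f {..<m + n} = sum f {..<m} + (\<Sum>i<n. f (m + i))"
  for f :: "nat \<Rightarrow> 'b::comm_monoid_add"
  by (induction n) (auto simp: algebra_simps)

text \<open>The syzygies of \<open>g\<^sub>0, \<dots>, g\<^sub>n\<close> are those of \<open>g\<^sub>0, \<dots>, g\<^bsub>n-1\<^esub>\<close> together with one syzygy for each
  generator of the colon ideal of \<open>g\<^sub>n\<close>; the colon ideals of the extended list are old ones or come
  from the filtration.\<close>

lemma linear_quotients_syzygies:
  assumes F: "koszul_filtration F"
  shows "linear_quotients F b n g \<Longrightarrow> \<exists>n' g'. linear_quotients F n n' g' \<and> syzygies b n g n' g'"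
proof (induction n)
  case 0
  have "linear_quotients F 0 0 g" "syzygies b 0 g 0 g"
    by (auto simp: linear_quotients_def syzygies_def vspan_def)
  then show ?case by blast
next
  case (Suc n)
  then obtain n' g0 where IH: "linear_quotients F n n' g0" "syzygies b n g n' g0"
    by (auto simp: linear_quotients_def)
  have g1: "g k j \<in> G 1" if "k \<le> n" "j < b" for k j
    using Suc.prems that by (auto simp: linear_quotients_def)
  have g0: "g0 k j \<in> G 1" if "k < n'" "j < n" for k j
    using IH that by (auto simp: linear_quotients_def)
  obtain L where L: "L \<in> F" and Lcolon: "\<And>f. f \<in> B \<Longrightarrow> vspan b n g (\<lambda>j. f * g n j) \<longleftrightarrow> f \<in> lspan L"
    using Suc.prems by (auto simp: linear_quotients_def)
  have LG: "L ! s \<in> G 1" if "s < length L" for s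
    using F L that by (auto simp: koszul_filtration_def)
  have "\<exists>c. (\<forall>i<n. c i \<in> G 1) \<and> (\<forall>j<b. L ! s * g n j = (\<Sum>i<n. c i * g i j))" if s: "s < length L" for s
  proof -
    have "vspan b n g (\<lambda>j. L ! s * g n j)"
      using Lcolon[OF G_closed[OF LG[OF s]]] lspan_generator[OF s] by simp
    then obtain c where c: "\<And>i. i < n \<Longrightarrow> c i \<in> B" "\<And>j. j < b \<Longrightarrow> L ! s * g n j = (\<Sum>i<n. c i * g i j)"
      by (auto simp: vspan_def)
    \<comment> \<open>Both sides have degree two and the \<open>g i j\<close> have degree one, so
      the coefficients may be replaced by their parts of degree one. This keeps the new syzygies
      linear.\<close>
    have "L ! s * g n j = (\<Sum>i<n. proj 1 (c i) * g i j)" if j: "j < b" for j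
    proof -
      have "L ! s * g n j = proj (1 + 1) (L ! s * g n j)"
        using G_mult[OF LG[OF s] g1[OF order_refl j]] by (simp only: proj_id)
      also have "\<dots> = (\<Sum>i<n. proj (1 + 1) (c i * g i j))"
        unfolding c(2)[OF j] proj_sum ..
      also have "\<dots> = (\<Sum>i<n. proj 1 (c i) * g i j)"
        using c(1) g1 j by (intro sum.cong refl proj_mult) auto
      finally show ?thesis .
    qed
    then show ?thesis
      using c(1) by (intro exI[of _ "\<lambda>i. proj 1 (c i)"]) (auto intro: proj_G)
  qed
  then obtain d where dG: "\<And>s i. s < length L \<Longrightarrow> i < n \<Longrightarrow> d s i \<in> G 1"
    and d: "\<And>s j. s < length L \<Longrightarrow> j < b \<Longrightarrow> L ! s * g n j = (\<Sum>i<n. d s i * g i j)"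
    by metis
  \<comment> \<open>Block form: the old syzygies get 0 in the new coordinate \<open>n\<close>, the
    additional rows express each \<open>L ! s * g n\<close> by the earlier vectors. Coordinate
    \<open>n\<close> of the additional rows is the list \<open>L\<close>.\<close>
  define g' where "g' l k =
    (if l < n' then (if k < n then g0 l k else 0) else (if k < n then - d (l - n') k else L ! (l - n')))" for l k
  have g'G: "g' l k \<in> G 1" if "l < n' + length L" "k < Suc n" for l k
    using that by (auto simp: g'_def simp flip: One_nat_def intro!: G_uminus dG g0 LG G_zero)
  have g'syz: "(\<Sum>k<Suc n. g' l k * g k j) = 0" if l: "l < n' + length L" and j: "j < b" for l j
  proof (cases "l < n'")
    case True
    have "vspan n n' g0 (g0 l)"
      using True by (rule vspan_generator)
    moreover have "\<forall>k<n. g0 l k \<in> B"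
      using g0 True G_closed by auto
    ultimately have "(\<Sum>k<n. g0 l k * g k j) = 0"
      using IH(2) j by (auto simp: syzygies_def)
    with True show ?thesis by (simp add: g'_def)
  next
    case False
    with l have "l - n' < length L" by auto
    from d[OF this j] False show ?thesis by (simp add: g'_def sum_negf)
  qed
  have comb_syz: "(\<Sum>k<Suc n. (\<Sum>l<N. c l * g' l k) * g k j) = 0" if "N \<le> n' + length L" "j < b" for c N j
  proof -
    have "(\<Sum>k<Suc n. (\<Sum>l<N. c l * g' l k) * g k j) = (\<Sum>l<N. c l * (\<Sum>k<Suc n. g' l k * g k j))"
      unfolding sum_distrib_right sum_distrib_left by (subst sum.swap) (simp only: mult.assoc)
    also have "\<dots> = 0"
      using that g'syz by (intro sum.neutral) (auto simp del: sum.lessThan_Suc)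
    finally show ?thesis .
  qed
  \<comment> \<open>A syzygy whose last coordinate lies in the ideal of the first \<open>s\<close>
    elements of \<open>L\<close> becomes an old syzygy after subtracting the matching combination of
    additional rows. With \<open>s = length L\<close> this gives generation, with smaller
    \<open>s\<close> the colon ideals.\<close>
  have core: "vspan (Suc n) (n' + s) g' z"
    if z: "\<And>k. k < Suc n \<Longrightarrow> z k \<in> B" "\<And>j. j < b \<Longrightarrow> (\<Sum>k<Suc n. z k * g k j) = 0"
      and e: "\<And>t. t < s \<Longrightarrow> e t \<in> B" "z n = (\<Sum>t<s. e t * L ! t)" and s: "s \<le> length L" for z e s
  proof -
    define w where "w k = z k - (\<Sum>t<s. e t * g' (n' + t) k)" for k
    have g'B: "g' (n' + t) k \<in> B" if "t < s" "k < Suc n" for t k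
      using g'G[of "n' + t" k] s that G_closed by auto
    have wB: "\<forall>k<n. w k \<in> B"
      unfolding w_def using z(1) e(1) g'B by (auto intro!: diff_closed sum_closed mult_closed)
    have wn: "w n = 0"
      by (simp add: w_def e(2) g'_def)
    have "(\<Sum>k<n. w k * g k j) = 0" if j: "j < b" for j
    proof -
      have "(\<Sum>k<Suc n. (\<Sum>t<s. e t * g' (n' + t) k) * g k j) = (\<Sum>t<s. e t * (\<Sum>k<Suc n. g' (n' + t) k * g k j))"
        unfolding sum_distrib_right sum_distrib_left by (subst sum.swap) (simp only: mult.assoc)
      also have "\<dots> = 0"
        using s j g'syz by (intro sum.neutral) (auto simp del: sum.lessThan_Suc)
      finally have "(\<Sum>k<Suc n. w k * g k j) = 0"
        using z(2)[OF j] by (simp add: w_def left_diff_distrib sum_subtractf)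
      then show ?thesis by (simp add: wn)
    qed
    then have "vspan n n' g0 w"
      using IH(2) wB unfolding syzygies_def by blast
    then obtain a where a: "\<And>l. l < n' \<Longrightarrow> a l \<in> B" "\<And>k. k < n \<Longrightarrow> w k = (\<Sum>l<n'. a l * g0 l k)"
      unfolding vspan_def by blast
    define c where "c l = (if l < n' then a l else e (l - n'))" for l
    have "z k = (\<Sum>l<n' + s. c l * g' l k)" if "k < Suc n" for k
    proof -
      have "w k = (\<Sum>l<n'. a l * g' l k)"
        using a(2)[of k] wn that by (cases "k < n") (auto simp: g'_def less_Suc_eq)
      then show ?thesis
        by (simp add: sum_lessThan_add c_def w_def algebra_simps)
    qed
    moreover have "\<forall>l<n' + s. c l \<in> B"
      using a(1) e(1) by (auto simp: c_def)
    ultimately show ?thesis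
      unfolding vspan_def by blast
  qed
  have "syzygies b (Suc n) g (n' + length L) g'"
    unfolding syzygies_def
  proof (intro allI impI iffI)
    fix z j assume zB: "\<forall>k<Suc n. z k \<in> B" and "vspan (Suc n) (n' + length L) g' z" and j: "j < b"
    then obtain c where "\<And>k. k < Suc n \<Longrightarrow> z k = (\<Sum>l<n' + length L. c l * g' l k)"
      by (auto simp: vspan_def)
    then have "(\<Sum>k<Suc n. z k * g k j) = (\<Sum>k<Suc n. (\<Sum>l<n' + length L. c l * g' l k) * g k j)"
      by (intro sum.cong) auto
    then show "(\<Sum>k<Suc n. z k * g k j) = 0"
      using comb_syz[OF order_refl j] by simp
  next
    fix z assume zB: "\<forall>k<Suc n. z k \<in> B" and z0: "\<forall>j<b. (\<Sum>k<Suc n. z k * g k j) = 0"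
    have "z n * g n j = (\<Sum>k<n. - z k * g k j)" if "j < b" for j
      using z0 that by (auto simp: sum_negf add_eq_0_iff2)
    then have "vspan b n g (\<lambda>j. z n * g n j)"
      unfolding vspan_def using zB by (intro exI[of _ "\<lambda>k. - z k"]) (auto intro: uminus_closed)
    then have "z n \<in> lspan L"
      using Lcolon zB by auto
    then obtain e where "\<forall>t<length L. e t \<in> B" "z n = (\<Sum>t<length L. e t * L ! t)"
      by (auto simp: lspan_def)
    then show "vspan (Suc n) (n' + length L) g' z"
      using zB z0 by (intro core) auto
  qed
  moreover have "\<exists>L'\<in>F. \<forall>f\<in>B. vspan (Suc n) l g' (\<lambda>k. f * g' l k) \<longleftrightarrow> f \<in> lspan L'"
    if l: "l < n' + length L" for l
  proof (cases "l < n'")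
    case True
    \<comment> \<open>This row and all earlier ones vanish in coordinate \<open>n\<close>, so the
      colon ideal is that of \<open>g0\<close>.\<close>
    have "vspan (Suc n) l g' (\<lambda>k. f * g' l k) \<longleftrightarrow> vspan n l g0 (\<lambda>k. f * g0 l k)" for f
      using True by (simp add: vspan_def g'_def All_less_Suc cong: conj_cong)
    then show ?thesis
      using IH(1) True by (simp add: linear_quotients_def)
  next
    case False
    define s where "s = l - n'"
    have l': "l = n' + s" and s: "s < length L"
      using False l by (auto simp: s_def)
    \<comment> \<open>One direction reads off coordinate \<open>n\<close>, where the earlier rows
      contribute only \<open>L ! t\<close> with \<open>t < s\<close>; the converse applies
      \<open>core\<close> to the syzygy \<open>f * g' l\<close>.\<close>
    have "vspan (Suc n) l g' (\<lambda>k. f * g' l k) \<longleftrightarrow> f * L ! s \<in> lspan (take s L)" if f: "f \<in> B" for f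
    proof
      assume "vspan (Suc n) l g' (\<lambda>k. f * g' l k)"
      then obtain c where c: "\<forall>i<l. c i \<in> B" "f * g' l n = (\<Sum>i<l. c i * g' i n)"
        by (auto simp: vspan_def)
      then have "f * L ! s = (\<Sum>t<s. c (n' + t) * L ! t)"
        by (simp add: l' sum_lessThan_add g'_def)
      then show "f * L ! s \<in> lspan (take s L)"
        unfolding lspan_def using c(1) s by (auto simp: l' intro!: exI[of _ "\<lambda>t. c (n' + t)"])
    next
      assume "f * L ! s \<in> lspan (take s L)"
      then obtain e where e: "\<forall>t<s. e t \<in> B" "f * L ! s = (\<Sum>t<s. e t * L ! t)"
        using s by (auto simp: lspan_def)
      have "(\<Sum>k<Suc n. f * g' l k * g k j) = 0" if "j < b" for j
        using g'syz[OF l that] by (simp add: sum_distrib_left[symmetric] mult.assoc distrib_left[symmetric] del: sum.lessThan_Suc)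
      moreover have "f * g' l k \<in> B" if "k < Suc n" for k
        using f g'G[OF l that] G_closed mult_closed by blast
      moreover have "f * g' l n = (\<Sum>t<s. e t * L ! t)"
        using e(2) by (simp add: g'_def l')
      ultimately show "vspan (Suc n) l g' (\<lambda>k. f * g' l k)"
        unfolding l' using e(1) s by (intro core) (auto simp: l')
    qed
    moreover have "\<exists>L'\<in>F. \<forall>f\<in>B. f * L ! s \<in> lspan (take s L) \<longleftrightarrow> f \<in> lspan L'"
      using F L s by (auto simp: koszul_filtration_def)
    ultimately show ?thesis
      by auto
  qed
  then have "linear_quotients F (Suc n) (n' + length L) g'"
    using g'G by (simp add: linear_quotients_def)
  ultimately show ?case by blast
qed

section \<open>Matrices of linear forms and the resolution of the residue field\<close>

definition matrix_hom :: "nat \<Rightarrow> nat \<Rightarrow> (nat \<Rightarrow> nat \<Rightarrow> 'a) \<Rightarrow> (nat \<Rightarrow> 'a) \<Rightarrow> nat \<Rightarrow> 'a"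
  where "matrix_hom b n g z = (\<lambda>j\<in>{..<b}. \<Sum>k<n. z k * g k j)"

lemma matrix_hom_closed:
  assumes "\<And>k j. k < n \<Longrightarrow> j < b \<Longrightarrow> g k j \<in> G 1" "z \<in> {..<n} \<rightarrow>\<^sub>E B"
  shows "matrix_hom b n g z \<in> {..<b} \<rightarrow>\<^sub>E B"
proof -
  have "z k * g k j \<in> B" if "k < n" "j < b" for k j
    using assms(1)[THEN G_closed, OF that] PiE_mem[OF assms(2)] that(1) by (simp add: mult_closed)
  then show ?thesis
    by (auto simp: matrix_hom_def intro!: sum_closed)
qed

text \<open>The row \<open>g k\<close> is the image of the \<open>k\<close>-th unit vector. Its
  entries have degree one, which makes up for the change of shift from \<open>Suc i\<close> to
  \<open>i\<close>.\<close>

lemma matrix_hom_graded: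
  assumes g: "\<And>k j. k < n \<Longrightarrow> j < b \<Longrightarrow> g k j \<in> G 1"
  shows "matrix_hom b n g \<in> graded_module_homs (subset_ring B)
    (free_module (subset_ring B) n) (free_grading (subset_ring B) G (Suc i) n)
    (free_module (subset_ring B) b) (free_grading (subset_ring B) G i b)"
proof -
  have "matrix_hom b n g \<in> module_homs (subset_ring B)
    (free_module (subset_ring B) n) (free_module (subset_ring B) b)"
    using matrix_hom_closed[OF g]
    by (auto simp: module_homs_def hom_def free_module_def matrix_hom_def fun_eq_iff
        distrib_right sum.distrib sum_distrib_left mult.assoc simp del: PiE_iff)
  moreover have "matrix_hom b n g z \<in> free_grading (subset_ring B) G i b e"
    if z: "z \<in> free_grading (subset_ring B) G (Suc i) n e" for z e
  proof (cases "Suc i \<le> e")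
    case True
    have "z k * g k j \<in> G (e - i)" if "k < n" "j < b" for k j
    proof -
      have "z k \<in> G (e - Suc i)"
        using z True that by (auto simp: free_grading_def)
      then show ?thesis
        using G_mult[OF _ g[OF that], of "z k" "e - Suc i"] True by (simp add: Suc_diff_Suc Suc_le_eq)
    qed
    then show ?thesis
      using True by (auto simp: free_grading_def matrix_hom_def intro!: G_sum)
  next
    case False
    \<comment> \<open>Below degree \<open>Suc i\<close> the source component is zero, so it does not
      matter whether the target component is \<open>G 0\<close> or zero.\<close>
    then have "z k = 0" if "k < n" for k
      using z that by (auto simp: free_grading_def)
    then show ?thesis
      by (auto simp: free_grading_def matrix_hom_def G_zero)
  qed
  ultimately show ?thesis
    by (auto simp: graded_module_homs_def)
qed

lemma matrix_hom_image:
  assumes "y \<in> {..<b} \<rightarrow>\<^sub>E B"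
  shows "y \<in> matrix_hom b n g ` ({..<n} \<rightarrow>\<^sub>E B) \<longleftrightarrow> vspan b n g y"
proof
  assume "y \<in> matrix_hom b n g ` ({..<n} \<rightarrow>\<^sub>E B)"
  then show "vspan b n g y"
    by (auto simp: vspan_def matrix_hom_def)
next
  assume "vspan b n g y"
  then obtain c where c: "\<forall>i<n. c i \<in> B" "\<forall>j<b. y j = (\<Sum>i<n. c i * g i j)"
    by (auto simp: vspan_def)
  then have "y = matrix_hom b n g (restrict c {..<n})" "restrict c {..<n} \<in> {..<n} \<rightarrow>\<^sub>E B"
    using assms by (auto simp: matrix_hom_def fun_eq_iff PiE_iff extensional_def)
  then show "y \<in> matrix_hom b n g ` ({..<n} \<rightarrow>\<^sub>E B)"
    by blast
qed

theorem koszul_filtration_koszul: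
  assumes F: "koszul_filtration F" and X: "X \<in> F"
    and irr: "irrelevant_ideal (subset_ring B) G = lspan X"
  shows "koszul (subset_ring B) G"
proof -
  interpret R: cring "subset_ring B" by (rule cring_subset_ring)
  have I: "ideal (lspan X) (subset_ring B)"
    unfolding irr[symmetric] irrelevant_ideal_def using G_closed by (intro R.genideal_ideal) auto
  interpret I: ideal "lspan X" "subset_ring B" by fact
  \<comment> \<open>A state \<open>(b, n, g)\<close> is a matrix of \<open>n\<close> rows of length
    \<open>b\<close>. \<open>P\<close> is the invariant, and \<open>Q\<close> makes the number of
    rows of one matrix the row length of the next. Dependent choice along \<open>Q\<close> produces
    the resolution.\<close>
  define P where "P = (\<lambda>(b, n, g). linear_quotients F b n g)"
  define Q where "Q = (\<lambda>(b, n, g) (b', n', g'). b' = n \<and> syzygies b n g n' g')"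
  have XG: "X ! k \<in> G 1" if "k < length X" for k
    using F X that by (auto simp: koszul_filtration_def)
  \<comment> \<open>For rows of length 1 the spanned submodules are ideals, so the filtration itself
    supplies the invariant for \<open>X\<close>.\<close>
  have "vspan 1 k (\<lambda>i j. X ! i) (\<lambda>j. f) \<longleftrightarrow> f \<in> lspan (take k X)" if "k < length X" for k f
    using that by (auto simp: vspan_def lspan_def)
  then have init: "P (1, length X, \<lambda>k j. X ! k)"
    using F X by (auto simp: P_def linear_quotients_def koszul_filtration_def)
  have step: "\<exists>y. P y \<and> Q x y" if "P x" for x
  proof -
    obtain b n g where x: "x = (b, n, g)" by (cases x)
    with that linear_quotients_syzygies[OF F] obtain n' g' where "linear_quotients F n n' g'" "syzygies b n g n' g'"
      unfolding P_def by blast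
    then have "P (n, n', g') \<and> Q x (n, n', g')"
      by (simp add: P_def Q_def x)
    then show ?thesis by blast
  qed
  obtain S where S0: "S 0 = (1, length X, \<lambda>k j. X ! k)" and S: "\<And>i. P (S i) \<and> Q (S i) (S (Suc i))"
  proof -
    define S where "S = rec_nat (1, length X, \<lambda>k j. X ! k) (\<lambda>_ x. SOME y. P y \<and> Q x y)"
    have S_Suc: "S (Suc i) = (SOME y. P y \<and> Q (S i) y)" for i
      by (simp add: S_def)
    have "P (S i)" for i
    proof (induction i)
      case 0
      then show ?case using init by (simp add: S_def)
    next
      case (Suc i)
      then show ?case unfolding S_Suc using someI_ex[OF step] by blast
    qed
    moreover have "Q (S i) (S (Suc i))" for i
      unfolding S_Suc using someI_ex[OF step[OF \<open>P (S i)\<close>]] by blast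
    ultimately show ?thesis
      using that[of S] by (simp add: S_def)
  qed
  define b where "b i = fst (S i)" for i
  define g where "g i = snd (snd (S i))" for i
  have "fst (snd (S i)) = b (Suc i)" for i
    using S[of i] unfolding Q_def b_def by (auto simp: case_prod_beta)
  then have S_eq: "S i = (b i, b (Suc i), g i)" for i
    by (simp add: b_def g_def prod_eq_iff)
  have LQ: "linear_quotients F (b i) (b (Suc i)) (g i)" for i
    using S[of i] by (simp add: P_def S_eq)
  have SZ: "syzygies (b i) (b (Suc i)) (g i) (b (Suc (Suc i))) (g (Suc i))" for i
    using S[of i] by (simp add: Q_def S_eq)
  have b0: "b 0 = 1" "b (Suc 0) = length X" "g 0 = (\<lambda>k j. X ! k)"
    using S0 S_eq[of 0] by simp_all
  have gG: "g i k j \<in> G 1" if "k < b (Suc i)" "j < b i" for i k j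
    using LQ[of i] that by (auto simp: linear_quotients_def)
  let ?R = "subset_ring B"
  define \<phi> where "\<phi> i = matrix_hom (b i) (b (Suc i)) (g i)" for i
  \<comment> \<open>Since \<open>b 0 = 1\<close>, a vector is its coordinate 0.\<close>
  define \<epsilon> where "\<epsilon> z = lspan X +>\<^bsub>?R\<^esub> z 0" for z :: "nat \<Rightarrow> 'a"
  have fc: "carrier (free_module ?R n) = {..<n} \<rightarrow>\<^sub>E B" for n
    by (simp add: free_module_def)
  have \<phi>: "\<phi> i \<in> graded_module_homs ?R (free_module ?R (b (Suc i))) (free_grading ?R G (Suc i) (b (Suc i)))
       (free_module ?R (b i)) (free_grading ?R G i (b i))" for i
    unfolding \<phi>_def using gG by (rule matrix_hom_graded)
  have \<phi>_closed: "\<phi> i ` ({..<b (Suc i)} \<rightarrow>\<^sub>E B) \<subseteq> {..<b i} \<rightarrow>\<^sub>E B" for i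
    unfolding \<phi>_def by (intro image_subsetI matrix_hom_closed gG)
  have z0: "z 0 \<in> B" if "z \<in> {..<Suc 0} \<rightarrow>\<^sub>E B" for z
    using that by auto
  have \<epsilon>: "\<epsilon> \<in> graded_module_homs ?R (free_module ?R (b 0)) (free_grading ?R G 0 (b 0))
      (quot_module ?R (lspan X)) (quot_grading ?R G (lspan X))"
    using I.a_rcos_sum I.rcoset_mult_add R.a_rcosetsI[OF I.a_subset] z0
    by (auto simp: graded_module_homs_def module_homs_def hom_def b0 \<epsilon>_def free_module_def quot_module_def
        free_grading_def quot_grading_def FactRing_def)
  have surj: "\<epsilon> ` carrier (free_module ?R (b 0)) = carrier (quot_module ?R (lspan X))"
  proof -
    have "lspan X +>\<^bsub>?R\<^esub> a \<in> \<epsilon> ` ({..<Suc 0} \<rightarrow>\<^sub>E B)" if "a \<in> B" for a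
      using that by (intro image_eqI[where x = "\<lambda>j\<in>{..<Suc 0}. a"]) (auto simp: \<epsilon>_def)
    then show ?thesis
      using z0 by (auto simp: fc b0 quot_module_def FactRing_def A_RCOSETS_def' \<epsilon>_def)
  qed
  have eq_CollectI: "I = {y \<in> A. P y}" if "I \<subseteq> A" "\<And>y. y \<in> A \<Longrightarrow> P y \<longleftrightarrow> y \<in> I"
    for I A :: "(nat \<Rightarrow> 'a) set" and P
    using that by blast
  have ex0: "\<phi> 0 ` carrier (free_module ?R (b 1)) = a_kernel (free_module ?R (b 0)) (quot_module ?R (lspan X)) \<epsilon>"
  proof -
    have "\<epsilon> y = lspan X \<longleftrightarrow> y \<in> \<phi> 0 ` ({..<b 1} \<rightarrow>\<^sub>E B)" if y: "y \<in> {..<b 0} \<rightarrow>\<^sub>E B" for y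
    proof -
      have "y 0 \<in> B"
        using y z0 by (simp add: b0)
      then have "\<epsilon> y = lspan X \<longleftrightarrow> y 0 \<in> lspan X"
        using I.a_rcos_const[of "y 0"] I.a_rcos_self[of "y 0"] by (auto simp: \<epsilon>_def)
      also have "\<dots> \<longleftrightarrow> vspan (b 0) (b 1) (g 0) y"
        by (simp add: vspan_def lspan_def b0)
      finally show ?thesis
        using matrix_hom_image[OF y] by (simp add: \<phi>_def)
    qed
    moreover have "\<zero>\<^bsub>quot_module ?R (lspan X)\<^esub> = lspan X"
      by (simp add: quot_module_def FactRing_def)
    ultimately show ?thesis
      unfolding a_kernel_def' fc using \<phi>_closed[of 0] by (intro eq_CollectI) simp_all
  qed
  have ex: "\<phi> (Suc i) ` carrier (free_module ?R (b (Suc (Suc i)))) =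
       a_kernel (free_module ?R (b (Suc i))) (free_module ?R (b i)) (\<phi> i)" for i
  proof -
    have "\<phi> i y = (\<lambda>j\<in>{..<b i}. 0) \<longleftrightarrow> y \<in> \<phi> (Suc i) ` ({..<b (Suc (Suc i))} \<rightarrow>\<^sub>E B)"
      if y: "y \<in> {..<b (Suc i)} \<rightarrow>\<^sub>E B" for y
    proof -
      have "\<phi> i y = (\<lambda>j\<in>{..<b i}. 0) \<longleftrightarrow> (\<forall>j<b i. (\<Sum>k<b (Suc i). y k * g i k j) = 0)"
        by (auto simp: \<phi>_def matrix_hom_def fun_eq_iff)
      also have "\<dots> \<longleftrightarrow> vspan (b (Suc i)) (b (Suc (Suc i))) (g (Suc i)) y"
        using SZ[of i] y by (auto simp: syzygies_def)
      finally show ?thesis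
        using matrix_hom_image[OF y] by (simp add: \<phi>_def)
    qed
    moreover have "\<zero>\<^bsub>free_module ?R (b i)\<^esub> = (\<lambda>j\<in>{..<b i}. 0)"
      by (simp add: free_module_def)
    ultimately show ?thesis
      unfolding a_kernel_def' fc using \<phi>_closed[of "Suc i"] by (intro eq_CollectI) simp_all
  qed
  have "linear_free_resolution ?R G (quot_module ?R (lspan X)) (quot_grading ?R G (lspan X)) b \<phi> \<epsilon>"
    unfolding linear_free_resolution_def using \<epsilon> \<phi> surj ex0 ex by blast
  then show ?thesis
    unfolding koszul_def has_linear_free_resolution_def irr by blast
qed

lemma lspan_closed: "f \<in> lspan L \<Longrightarrow> (\<And>x. x \<in> set L \<Longrightarrow> x \<in> B) \<Longrightarrow> f \<in> B"
  by (auto simp: lspan_def intro!: sum_closed mult_closed)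

lemma lspan_zero: "0 \<in> lspan L"
  unfolding lspan_def by (rule CollectI, rule exI[of _ "\<lambda>_. 0"]) (auto intro: zero_closed)

lemma lspan_add:
  assumes "f \<in> lspan L" and "g \<in> lspan L"
  shows "f + g \<in> lspan L"
proof -
  obtain c d where "\<forall>i<length L. c i \<in> B" "f = (\<Sum>i<length L. c i * L ! i)"
    "\<forall>i<length L. d i \<in> B" "g = (\<Sum>i<length L. d i * L ! i)"
    using assms by (auto simp: lspan_def)
  then show ?thesis
    unfolding lspan_def
    by (intro CollectI exI[of _ "\<lambda>i. c i + d i"]) (auto simp: distrib_right sum.distrib intro: add_closed)
qed

lemma lspan_mult:
  assumes "f \<in> lspan L" and "a \<in> B"
  shows "a * f \<in> lspan L"
proof -
  obtain c where "\<forall>i<length L. c i \<in> B" "f = (\<Sum>i<length L. c i * L ! i)"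
    using assms by (auto simp: lspan_def)
  then show ?thesis
    unfolding lspan_def using assms(2)
    by (intro CollectI exI[of _ "\<lambda>i. a * c i"]) (auto simp: sum_distrib_left mult.assoc intro: mult_closed)
qed

lemma lspan_sum: "(\<And>i. i \<in> I \<Longrightarrow> f i \<in> lspan L) \<Longrightarrow> sum f I \<in> lspan L"
  by (induction I rule: infinite_finite_induct) (auto intro: lspan_add lspan_zero)

lemma ideal_subset_ringI:
  assumes "I \<subseteq> B" and "0 \<in> I" and "\<And>f g. f \<in> I \<Longrightarrow> g \<in> I \<Longrightarrow> f + g \<in> I"
    and "\<And>a f. a \<in> B \<Longrightarrow> f \<in> I \<Longrightarrow> a * f \<in> I"
  shows "ideal I (subset_ring B)"
proof -
  interpret R: cring "subset_ring B" by (rule cring_subset_ring)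
  have "\<ominus>\<^bsub>subset_ring B\<^esub> f \<in> I" if "f \<in> I" for f
  proof -
    have "f \<in> B" using that assms(1) by auto
    then have "\<ominus>\<^bsub>subset_ring B\<^esub> f = - f"
      using R.minus_equality[of "- f" f] uminus_closed by simp
    also have "\<dots> = - 1 * f" by simp
    also have "\<dots> \<in> I"
      using assms(4) that uminus_closed[OF one_closed] by blast
    finally show ?thesis .
  qed
  then have "subgroup I (add_monoid (subset_ring B))"
    using assms by (intro R.add.subgroupI) (auto simp: a_inv_def)
  then show ?thesis
    using assms(4) by (intro idealI R.ring_axioms) (simp, simp, metis mult.commute subset_ring_simps(1,2))
qed

lemma irrelevant_ideal_eqI:
  assumes "\<And>d. d \<ge> 1 \<Longrightarrow> G d \<subseteq> lspan X" and X: "\<And>x. x \<in> set X \<Longrightarrow> x \<in> G 1"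
  shows "irrelevant_ideal (subset_ring B) G = lspan X"
proof
  interpret R: cring "subset_ring B" by (rule cring_subset_ring)
  let ?U = "\<Union>d\<in>{1..}. G d"
  have U: "?U \<subseteq> carrier (subset_ring B)"
    using G_closed by auto
  have XB: "x \<in> B" if "x \<in> set X" for x
    using G_closed X that by blast
  have "ideal (lspan X) (subset_ring B)"
    by (rule ideal_subset_ringI) (auto intro: lspan_closed lspan_zero lspan_add lspan_mult XB)
  then show "irrelevant_ideal (subset_ring B) G \<subseteq> lspan X"
    unfolding irrelevant_ideal_def using assms(1) by (intro R.genideal_minimal) auto
  interpret I: ideal "irrelevant_ideal (subset_ring B) G" "subset_ring B"
    unfolding irrelevant_ideal_def by (rule R.genideal_ideal[OF U])
  have XI: "x \<in> irrelevant_ideal (subset_ring B) G" if "x \<in> set X" for x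
    unfolding irrelevant_ideal_def using R.genideal_self[OF U] X[OF that] by auto
  have sum_I: "sum f J \<in> irrelevant_ideal (subset_ring B) G"
    if "\<And>i. i \<in> J \<Longrightarrow> f i \<in> irrelevant_ideal (subset_ring B) G" for f and J :: "nat set"
    using that I.a_closed I.zero_closed
    by (induction J rule: infinite_finite_induct) auto
  show "lspan X \<subseteq> irrelevant_ideal (subset_ring B) G"
    using I.I_l_closed XI by (auto simp: lspan_def intro!: sum_I)
qed

end

section \<open>Monoid algebras\<close>

lemma poly_mapping_sum_single: "p = (\<Sum>a\<in>Poly_Mapping.keys p. Poly_Mapping.single a (Poly_Mapping.lookup p a))"
  by (rule poly_mapping_eqI)
    (auto simp: lookup_sum lookup_single when_def sum.delta' in_keys_iff)

lemma lookup_times: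
  "Poly_Mapping.lookup (f * g) k = (\<Sum>a\<in>Poly_Mapping.keys f. \<Sum>b\<in>Poly_Mapping.keys g.
     if a + b = k then Poly_Mapping.lookup f a * Poly_Mapping.lookup g b else 0)"
proof -
  have "f * g = (\<Sum>a\<in>Poly_Mapping.keys f. \<Sum>b\<in>Poly_Mapping.keys g.
      Poly_Mapping.single (a + b) (Poly_Mapping.lookup f a * Poly_Mapping.lookup g b))"
    by (subst poly_mapping_sum_single[of f], subst poly_mapping_sum_single[of g])
      (simp only: sum_product mult_single)
  then show ?thesis
    by (simp add: lookup_sum lookup_single when_def)
qed

text \<open>Only one pair of keys contributes to the convolution sum. Through this lemma uniqueness
  of decompositions in the exponent monoid makes coefficients multiplicative.\<close>

lemma lookup_times_unique:
  assumes "\<And>x y. x \<in> Poly_Mapping.keys f \<Longrightarrow> y \<in> Poly_Mapping.keys g \<Longrightarrow> x + y = a + b \<Longrightarrow> x = a \<and> y = b"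
  shows "Poly_Mapping.lookup (f * g) (a + b) = Poly_Mapping.lookup f a * Poly_Mapping.lookup g b"
proof -
  have "Poly_Mapping.lookup (f * g) (a + b) = (\<Sum>x\<in>Poly_Mapping.keys f. \<Sum>y\<in>Poly_Mapping.keys g.
      if y = b then if x = a then Poly_Mapping.lookup f a * Poly_Mapping.lookup g b else 0 else 0)"
    unfolding lookup_times using assms by (intro sum.cong refl) auto
  then show ?thesis
    by (cases "a \<in> Poly_Mapping.keys f"; cases "b \<in> Poly_Mapping.keys g")
      (simp_all add: sum.delta not_in_keys_iff_lookup_eq_zero)
qed

definition monoid_algebra :: "(nat \<times> nat) set \<Rightarrow> ((nat \<times> nat) \<Rightarrow>\<^sub>0 'k::field) set"
  where "monoid_algebra S = {p. Poly_Mapping.keys p \<subseteq> S}"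

definition monoid_grading :: "(nat \<times> nat) set \<Rightarrow> nat \<Rightarrow> ((nat \<times> nat) \<Rightarrow>\<^sub>0 'k::field) set"
  where "monoid_grading S d = {p. Poly_Mapping.keys p \<subseteq> {s \<in> S. fst s = d}}"

definition deg_part :: "nat \<Rightarrow> ((nat \<times> nat) \<Rightarrow>\<^sub>0 'k::field) \<Rightarrow> (nat \<times> nat) \<Rightarrow>\<^sub>0 'k"
  where "deg_part d p = Poly_Mapping.mapp (\<lambda>k c. c when fst k = d) p"

definition monomial :: "'a \<Rightarrow> 'a \<Rightarrow>\<^sub>0 'k::field"
  where "monomial a = Poly_Mapping.single a 1"

lemma lookup_deg_part: "Poly_Mapping.lookup (deg_part d p) k = (Poly_Mapping.lookup p k when fst k = d)"
  by (auto simp: deg_part_def lookup_mapp when_def in_keys_iff)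

lemma lookup_times_monomial:
  fixes a :: "'a::cancel_comm_monoid_add" and p :: "'a \<Rightarrow>\<^sub>0 'k::field"
  shows "Poly_Mapping.lookup (p * monomial a) (k + a) = Poly_Mapping.lookup p k"
  by (subst lookup_times_unique) (auto simp: monomial_def)

lemma keys_times_monomial:
  fixes a :: "'a::cancel_comm_monoid_add" and p :: "'a \<Rightarrow>\<^sub>0 'k::field"
  shows "Poly_Mapping.keys (p * monomial a) = (\<lambda>k. k + a) ` Poly_Mapping.keys p"
proof
  show "Poly_Mapping.keys (p * monomial a) \<subseteq> (\<lambda>k. k + a) ` Poly_Mapping.keys p"
    using keys_mult[of p "monomial a"] unfolding monomial_def by (simp add: subset_iff image_iff) blast
  show "(\<lambda>k. k + a) ` Poly_Mapping.keys p \<subseteq> Poly_Mapping.keys (p * monomial a)"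
    by (auto simp: in_keys_iff lookup_times_monomial)
qed

text \<open>The first coordinate is the degree. By \<open>deg_zero\<close> the monoid algebra is
  connected: its component of degree 0 is \<open>K\<close>.\<close>

locale graded_monoid =
  fixes S :: "(nat \<times> nat) set"
  assumes zero_mem: "0 \<in> S"
    and add_mem: "a \<in> S \<Longrightarrow> b \<in> S \<Longrightarrow> a + b \<in> S"
    and deg_zero: "a \<in> S \<Longrightarrow> fst a = 0 \<Longrightarrow> a = 0"
begin

sublocale graded_subring "monoid_algebra S :: ((nat \<times> nat) \<Rightarrow>\<^sub>0 'k::field) set" "monoid_grading S" deg_part
proof
  fix x y :: "(nat \<times> nat) \<Rightarrow>\<^sub>0 'k" and d e :: nat
  have keys: "\<exists>a\<in>Poly_Mapping.keys x. \<exists>b\<in>Poly_Mapping.keys y. k = a + b"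
    if "k \<in> Poly_Mapping.keys (x * y)" for k
    using keys_mult[of x y] that by blast
  show "x * y \<in> monoid_algebra S" if "x \<in> monoid_algebra S" "y \<in> monoid_algebra S"
    unfolding monoid_algebra_def
  proof (intro CollectI subsetI)
    fix k assume "k \<in> Poly_Mapping.keys (x * y)"
    with keys obtain a b where "a \<in> Poly_Mapping.keys x" "b \<in> Poly_Mapping.keys y" "k = a + b"
      by blast
    then show "k \<in> S"
      using that add_mem by (simp add: monoid_algebra_def subsetD)
  qed
  show "x * y \<in> monoid_grading S (d + e)" if "x \<in> monoid_grading S d" "y \<in> monoid_grading S e"
    unfolding monoid_grading_def
  proof (intro CollectI subsetI)
    fix k assume "k \<in> Poly_Mapping.keys (x * y)"
    with keys obtain a b where k: "a \<in> Poly_Mapping.keys x" "b \<in> Poly_Mapping.keys y" "k = a + b"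
      by blast
    with that have "a \<in> {s \<in> S. fst s = d}" "b \<in> {s \<in> S. fst s = e}"
      by (auto simp only: monoid_grading_def mem_Collect_eq)
    then show "k \<in> S \<and> fst k = d + e"
      using k(3) add_mem by simp
  qed
  show "deg_part d x \<in> monoid_grading S d" if "x \<in> monoid_algebra S"
    using that unfolding monoid_algebra_def monoid_grading_def
    by (simp add: subset_iff in_keys_iff lookup_deg_part del: split_paired_All)
  show "deg_part d x = x" if "x \<in> monoid_grading S d"
    using that by (intro poly_mapping_eqI)
      (simp add: monoid_grading_def subset_iff in_keys_iff lookup_deg_part when_def del: split_paired_All, metis)
  show "deg_part d (x + y) = deg_part d x + deg_part d y"
    by (intro poly_mapping_eqI) (auto simp: lookup_deg_part lookup_add when_def)
  show "deg_part (d + e) (x * y) = deg_part d x * y" if y: "y \<in> monoid_grading S e"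
  proof (rule poly_mapping_eqI)
    fix k
    have y': "fst b = e" if "b \<in> Poly_Mapping.keys y" for b
      using that y by (auto simp: monoid_grading_def)
    have sub: "Poly_Mapping.keys (deg_part d x) \<subseteq> Poly_Mapping.keys x"
      by (auto simp: in_keys_iff lookup_deg_part when_def split: if_splits)
    have "Poly_Mapping.lookup (deg_part d x * y) k = (\<Sum>a\<in>Poly_Mapping.keys x. \<Sum>b\<in>Poly_Mapping.keys y.
     if a + b = k then Poly_Mapping.lookup (deg_part d x) a * Poly_Mapping.lookup y b else 0)"
      unfolding lookup_times using sub by (intro sum.mono_neutral_left) (auto simp: in_keys_iff intro!: sum.neutral)
    \<comment> \<open>Keys of \<open>y\<close> have degree \<open>e\<close>, so for
      \<open>a + b = k\<close> the conditions \<open>fst a = d\<close> and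
      \<open>fst k = d + e\<close> agree.\<close>
    also have "\<dots> = (\<Sum>a\<in>Poly_Mapping.keys x. \<Sum>b\<in>Poly_Mapping.keys y.
     if a + b = k then if fst k = d + e then Poly_Mapping.lookup x a * Poly_Mapping.lookup y b else 0 else 0)"
      using y' by (intro sum.cong refl) (auto simp: lookup_deg_part when_def)
    also have "\<dots> = Poly_Mapping.lookup (deg_part (d + e) (x * y)) k"
      by (cases "fst k = d + e") (simp_all add: lookup_deg_part lookup_times cong: if_cong)
    finally show "Poly_Mapping.lookup (deg_part (d + e) (x * y)) k = Poly_Mapping.lookup (deg_part d x * y) k"
      by simp
  qed
  show "x + y \<in> monoid_algebra S" if "x \<in> monoid_algebra S" "y \<in> monoid_algebra S"
    using that Poly_Mapping.keys_add[of x y] by (auto simp: monoid_algebra_def)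
  show "x + y \<in> monoid_grading S d" if "x \<in> monoid_grading S d" "y \<in> monoid_grading S d"
    using that Poly_Mapping.keys_add[of x y] by (auto simp: monoid_grading_def)
qed (auto simp: monoid_algebra_def monoid_grading_def zero_mem in_keys_iff)

section \<open>Monomial ideals and filtrations by exponents\<close>

lemma monomial_mem: "a \<in> S \<Longrightarrow> monomial a \<in> monoid_algebra S"
  by (simp add: monomial_def monoid_algebra_def)

lemma monomial_grading: "a \<in> S \<Longrightarrow> fst a = d \<Longrightarrow> monomial a \<in> monoid_grading S d"
  by (simp add: monomial_def monoid_grading_def)

text \<open>A key of a combination is a key of one of its summands, and conversely each term is a
  multiple of a generator. So membership in a monomial ideal does not see the coefficients.\<close>

lemma lspan_monomial:
  fixes p :: "(nat \<times> nat) \<Rightarrow>\<^sub>0 'k::field"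
  assumes L: "set L \<subseteq> S"
  shows "p \<in> lspan (map monomial L) \<longleftrightarrow> (\<forall>k\<in>Poly_Mapping.keys p. \<exists>a\<in>set L. \<exists>s\<in>S. k = a + s)"
proof
  assume "p \<in> lspan (map monomial L)"
  then obtain c where c: "\<And>i. i < length L \<Longrightarrow> c i \<in> monoid_algebra S" "p = (\<Sum>i<length L. c i * monomial (L ! i))"
    by (auto simp: lspan_def)
  show "\<forall>k\<in>Poly_Mapping.keys p. \<exists>a\<in>set L. \<exists>s\<in>S. k = a + s"
  proof
    fix k assume "k \<in> Poly_Mapping.keys p"
    with keys_sum[of "\<lambda>i. c i * monomial (L ! i)" "{..<length L}"] obtain i
      where i: "i < length L" "k \<in> Poly_Mapping.keys (c i * monomial (L ! i))"
      by (auto simp: c(2))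
    then obtain s where "s \<in> Poly_Mapping.keys (c i)" "k = L ! i + s"
      by (auto simp: keys_times_monomial add.commute)
    moreover have "s \<in> S"
      using c(1)[OF i(1)] \<open>s \<in> _\<close> by (auto simp: monoid_algebra_def)
    ultimately show "\<exists>a\<in>set L. \<exists>s\<in>S. k = a + s"
      using \<open>k = _\<close> nth_mem[OF i(1)] by blast
  qed
next
  assume p: "\<forall>k\<in>Poly_Mapping.keys p. \<exists>a\<in>set L. \<exists>s\<in>S. k = a + s"
  have "Poly_Mapping.single k (Poly_Mapping.lookup p k) \<in> lspan (map monomial L)" if k: "k \<in> Poly_Mapping.keys p" for k
  proof -
    obtain a s where a: "a \<in> set L" "s \<in> S" "k = a + s"
      using p k by blast
    then obtain i where i: "i < length L" "a = L ! i"
      by (auto simp: in_set_conv_nth)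
    have "(map monomial L ! i :: (nat \<times> nat) \<Rightarrow>\<^sub>0 'k) \<in> lspan (map monomial L)"
      using i by (intro lspan_generator) simp
    then have "Poly_Mapping.single s (Poly_Mapping.lookup p k) * map monomial L ! i \<in> lspan (map monomial L)"
      using a(2) by (intro lspan_mult) (auto simp: monoid_algebra_def)
    then show ?thesis
      using i a(3) by (simp add: monomial_def mult_single add.commute)
  qed
  then show "p \<in> lspan (map monomial L)"
    by (subst poly_mapping_sum_single) (rule lspan_sum)
qed

definition monoid_filtration :: "(nat \<times> nat) list set \<Rightarrow> bool"
  where "monoid_filtration F \<longleftrightarrow> (\<forall>L\<in>F. set L \<subseteq> {a \<in> S. fst a = 1} \<and> (\<forall>s<length L. \<exists>L'\<in>F.
    \<forall>k\<in>S. (\<exists>a\<in>set (take s L). \<exists>t\<in>S. k + L ! s = a + t) \<longleftrightarrow> (\<exists>a\<in>set L'. \<exists>t\<in>S. k = a + t)))"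

text \<open>Multiplication by a monomial shifts the keys without cancellation, so the colon
  condition for \<open>f\<close> is the conjunction of those for its keys, where the field plays no
  part.\<close>

theorem monoid_filtration_koszul:
  assumes F: "monoid_filtration F" and X: "X \<in> F"
    and gen: "\<And>k. k \<in> S \<Longrightarrow> k \<noteq> 0 \<Longrightarrow> \<exists>a\<in>set X. \<exists>t\<in>S. k = a + t"
  shows "koszul (subset_ring (monoid_algebra S :: ((nat \<times> nat) \<Rightarrow>\<^sub>0 'k::field) set)) (monoid_grading S)"
proof (rule koszul_filtration_koszul)
  have FS: "set L \<subseteq> S" "\<And>a. a \<in> set L \<Longrightarrow> fst a = 1" if "L \<in> F" for L
    using F that by (auto simp: monoid_filtration_def)
  show "koszul_filtration (map monomial ` F :: ((nat \<times> nat) \<Rightarrow>\<^sub>0 'k) list set)"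
    unfolding koszul_filtration_def
  proof (intro ballI allI impI conjI)
    fix M :: "((nat \<times> nat) \<Rightarrow>\<^sub>0 'k) list" and s assume "M \<in> map monomial ` F" "s < length M"
    then obtain L where L: "L \<in> F" "M = map monomial L" "s < length L" by auto
    then show "M ! s \<in> monoid_grading S 1"
      using FS[OF L(1)] nth_mem[OF L(3)] by (simp add: monomial_grading subsetD)
    obtain L' where L': "L' \<in> F"
      "\<forall>k\<in>S. (\<exists>a\<in>set (take s L). \<exists>t\<in>S. k + L ! s = a + t) \<longleftrightarrow> (\<exists>a\<in>set L'. \<exists>t\<in>S. k = a + t)"
      using F L(1,3) unfolding monoid_filtration_def by blast
    have "f * M ! s \<in> lspan (take s M) \<longleftrightarrow> f \<in> lspan (map monomial L')" if "f \<in> monoid_algebra S" for f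
    proof -
      have "set (take s L) \<subseteq> S"
        using FS(1)[OF L(1)] set_take_subset[of s L] by blast
      then have "f * M ! s \<in> lspan (take s M) \<longleftrightarrow>
          (\<forall>k\<in>Poly_Mapping.keys f. \<exists>a\<in>set (take s L). \<exists>t\<in>S. k + L ! s = a + t)"
        using L(3) by (simp only: L(2) take_map lspan_monomial nth_map) (simp add: keys_times_monomial)
      also have "\<dots> \<longleftrightarrow> (\<forall>k\<in>Poly_Mapping.keys f. \<exists>a\<in>set L'. \<exists>t\<in>S. k = a + t)"
        using L'(2) that unfolding monoid_algebra_def by blast
      also have "\<dots> \<longleftrightarrow> f \<in> lspan (map monomial L')"
        by (rule lspan_monomial[OF FS(1)[OF L'(1)], symmetric])
      finally show ?thesis .
    qed
    then show "\<exists>L'\<in>map monomial ` F. \<forall>f\<in>monoid_algebra S. f * M ! s \<in> lspan (take s M) \<longleftrightarrow> f \<in> lspan L'"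
      using L'(1) by blast
  qed
  show "map monomial X \<in> map monomial ` F"
    using X by simp
  show "irrelevant_ideal (subset_ring (monoid_algebra S)) (monoid_grading S) = lspan (map (monomial :: _ \<Rightarrow> (nat \<times> nat) \<Rightarrow>\<^sub>0 'k) X)"
  proof (rule irrelevant_ideal_eqI)
    fix d :: nat assume "1 \<le> d"
    then show "monoid_grading S d \<subseteq> lspan (map (monomial :: _ \<Rightarrow> (nat \<times> nat) \<Rightarrow>\<^sub>0 'k) X)"
      using gen by (force simp: lspan_monomial[OF FS(1)[OF X]] monoid_grading_def)
  qed (use FS[OF X] in \<open>auto intro!: monomial_grading\<close>)
qed

end

section \<open>Consequences of an arbitrary linear resolution\<close>

definition free_unit :: "nat \<Rightarrow> nat \<Rightarrow> nat \<Rightarrow> 'a::comm_ring_1"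
  where "free_unit n k = (\<lambda>j\<in>{..<n}. if j = k then 1 else 0)"

context graded_subring
begin

lemma free_unit_closed: "free_unit n k \<in> {..<n} \<rightarrow>\<^sub>E B"
  by (auto simp: free_unit_def one_closed zero_closed)

lemma free_unit_grading: "free_unit n k \<in> free_grading (subset_ring B) G s n s"
  by (auto simp: free_unit_def free_grading_def G_one G_zero)

text \<open>The maps of a given resolution are abstract homomorphisms; this recovers their matrices,
  with rows \<open>\<phi> (free_unit n k)\<close>. The induction runs over the vectors
  \<open>t m\<close>, which keep the first \<open>m\<close> coordinates of \<open>z\<close>.\<close>

lemma module_homs_expand:
  assumes \<phi>: "\<phi> \<in> module_homs (subset_ring B) (free_module (subset_ring B) n) (free_module (subset_ring B) b)"
    and z: "z \<in> {..<n} \<rightarrow>\<^sub>E B" and i: "i < b"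
  shows "\<phi> z i = (\<Sum>k<n. z k * \<phi> (free_unit n k) i)"
proof -
  define t where "t m = (\<lambda>j\<in>{..<n}. if j < m then z j else 0)" for m
  have zB: "z j \<in> B" if "j < n" for j
    using z that by auto
  have t: "t m \<in> {..<n} \<rightarrow>\<^sub>E B" for m
    using zB by (auto simp: t_def zero_closed)
  have add: "\<phi> (\<lambda>j\<in>{..<n}. x j + y j) = (\<lambda>j\<in>{..<b}. \<phi> x j + \<phi> y j)"
    if "x \<in> {..<n} \<rightarrow>\<^sub>E B" "y \<in> {..<n} \<rightarrow>\<^sub>E B" for x y
    using \<phi> that by (auto simp: module_homs_def hom_def free_module_def)
  have smult: "\<phi> (\<lambda>j\<in>{..<n}. a * x j) = (\<lambda>j\<in>{..<b}. a * \<phi> x j)"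
    if "a \<in> B" "x \<in> {..<n} \<rightarrow>\<^sub>E B" for a x
    using \<phi> that by (auto simp: module_homs_def free_module_def)
  have "m \<le> n \<Longrightarrow> \<phi> (t m) i = (\<Sum>k<m. z k * \<phi> (free_unit n k) i)" for m
  proof (induction m)
    case 0
    have "t 0 = (\<lambda>j\<in>{..<n}. 0 * t 0 j)"
      by (auto simp: t_def)
    then have "\<phi> (t 0) = (\<lambda>j\<in>{..<b}. 0 * \<phi> (t 0) j)"
      using smult[OF zero_closed t] by metis
    with i have "\<phi> (t 0) i = 0 * \<phi> (t 0) i"
      by (metis lessThan_iff restrict_apply')
    then show ?case by simp
  next
    case (Suc m)
    define u where "u = (\<lambda>j\<in>{..<n}. z m * free_unit n m j)"
    have "u \<in> {..<n} \<rightarrow>\<^sub>E B"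
      using zB[of m] Suc.prems by (auto simp: u_def free_unit_def zero_closed)
    moreover have "t (Suc m) = (\<lambda>j\<in>{..<n}. t m j + u j)"
      by (auto simp: t_def u_def free_unit_def fun_eq_iff less_Suc_eq)
    ultimately have "\<phi> (t (Suc m)) i = \<phi> (t m) i + \<phi> u i"
      using add[OF t] i by simp
    also have "\<phi> u i = z m * \<phi> (free_unit n m) i"
      unfolding u_def using smult[OF zB free_unit_closed] Suc.prems i by simp
    finally show ?case
      using Suc by simp
  qed
  moreover have "t n = z"
    using z by (auto simp: t_def fun_eq_iff PiE_iff extensional_def)
  ultimately show ?thesis by auto
qed

end

context graded_monoid
begin

text \<open>If \<open>2p\<close> has no other decomposition but some \<open>dp\<close> does, then in degree \<open>d\<close> minimal the
  corresponding relation \<open>t\<^bsup>dp-p\<^esup> y\<^sub>p = t\<^bsup>dp-q\<^esup> y\<^sub>q\<close> is a minimal syzygy of the maximal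
  ideal. It is not a combination of linear syzygies because the functional taking the coefficient
  of \<open>t\<^bsup>dp-p\<^esup>\<close> in the coordinate of \<open>p\<close> vanishes on these.\<close>

theorem koszul_rigid:
  assumes koszul: "koszul (subset_ring (monoid_algebra S :: ((nat \<times> nat) \<Rightarrow>\<^sub>0 'k::field) set)) (monoid_grading S)"
    and p: "p \<in> S" "fst p = 1"
    and rigid: "\<And>q s. q \<in> S \<Longrightarrow> s \<in> S \<Longrightarrow> fst q = 1 \<Longrightarrow> q + s = p + p \<Longrightarrow> q = p"
  shows "q \<in> S \<Longrightarrow> s \<in> S \<Longrightarrow> fst q = 1 \<Longrightarrow> q + s = (d, d * snd p) \<Longrightarrow> q = p"
proof (induction d arbitrary: q s rule: less_induct)
  case (less d)
  let ?B = "monoid_algebra S :: ((nat \<times> nat) \<Rightarrow>\<^sub>0 'k) set"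
  let ?G = "monoid_grading S :: nat \<Rightarrow> ((nat \<times> nat) \<Rightarrow>\<^sub>0 'k) set"
  let ?R = "subset_ring ?B"
  let ?L = "Poly_Mapping.lookup :: ((nat \<times> nat) \<Rightarrow>\<^sub>0 'k) \<Rightarrow> _"
  show "q = p"
  proof (rule ccontr)
    assume "q \<noteq> p"
    have mult: "(e, e * snd p) \<in> S" for e
    proof (induction e)
      case 0
      then show ?case using zero_mem by (simp add: zero_prod_def)
    next
      case (Suc e)
      have "(Suc e, Suc e * snd p) = p + (e, e * snd p)"
        using p(2) by (simp add: prod_eq_iff)
      then show ?case using add_mem[OF p(1) Suc] by simp
    qed
    have s_deg: "d = Suc (fst s)"
      using less.prems by (simp add: prod_eq_iff)
    \<comment> \<open>In degree 0 only \<open>s = 0\<close> is possible, which gives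
      \<open>q = p\<close>. Hence \<open>d\<close> is at least 2.\<close>
    have "fst s \<noteq> 0"
    proof
      assume "fst s = 0"
      then have "s = 0" using deg_zero less.prems by blast
      with \<open>fst s = 0\<close> s_deg less.prems p(2) have "q = p"
        by (simp add: prod_eq_iff)
      with \<open>q \<noteq> p\<close> show False by simp
    qed
    then obtain e where e: "fst s = Suc e" "d = Suc (Suc e)"
      using s_deg by (cases "fst s") auto
    \<comment> \<open>With \<open>d = Suc (Suc e)\<close>, these are the multiples
      \<open>d - 1\<close> and \<open>d - 2\<close> of \<open>p\<close>.\<close>
    define t where "t = (Suc e, Suc e * snd p)"
    define t' where "t' = (e, e * snd p)"
    have tS: "t \<in> S" "t' \<in> S"
      using mult[of "Suc e"] mult[of e] by (simp_all only: t_def t'_def)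
    have tt: "t = t' + p" "q + s = p + t"
      using p(2) less.prems(4) by (simp_all add: t_def t'_def prod_eq_iff e)
    \<comment> \<open>By induction, \<open>p\<close> is the only element of degree one that can be
      split off from \<open>t\<close>. This later makes coefficients at \<open>t\<close>
      multiplicative.\<close>
    have low: "a = p" if "a \<in> S" "b \<in> S" "fst a = 1" "a + b = t" for a b
      using less.IH[of "Suc e" a b] that e by (simp add: t_def)
    interpret R: cring ?R by (rule cring_subset_ring)
    define I where "I = irrelevant_ideal ?R ?G"
    have U: "(\<Union>d\<in>{1..}. ?G d) \<subseteq> carrier ?R"
      using G_closed by auto
    interpret I: ideal I ?R
      unfolding I_def irrelevant_ideal_def by (rule R.genideal_ideal[OF U])
    have monomial_I: "monomial a \<in> I" if "a \<in> S" "fst a = 1" for a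
      unfolding I_def irrelevant_ideal_def using R.genideal_self[OF U] monomial_grading[OF that] by auto
    have keyS: "a \<in> S" if "a \<in> Poly_Mapping.keys x" "x \<in> ?B" for a x
      using that by (auto simp: monoid_algebra_def)
    have keyG: "a \<in> S" "fst a = i" if "a \<in> Poly_Mapping.keys x" "x \<in> ?G i" for a x i
      using that by (auto simp: monoid_grading_def)
    \<comment> \<open>The elements with constant term 0 form an ideal above all components of
      positive degree. Hence 1 is not in \<open>I\<close> and the residue field is nonzero.\<close>
    have "ideal {x \<in> ?B. ?L x 0 = 0} ?R"
    proof (rule ideal_subset_ringI)
      fix a f assume "a \<in> ?B" and f: "f \<in> {x \<in> ?B. ?L x 0 = 0}"
      have "?L (a * f) (0 + 0) = ?L a 0 * ?L f 0"
      proof (rule lookup_times_unique)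
        fix x y assume "x \<in> Poly_Mapping.keys a" "y \<in> Poly_Mapping.keys f" "x + y = 0 + 0"
        then show "x = 0 \<and> y = 0"
          by (simp add: prod_eq_iff)
      qed
      with f \<open>a \<in> ?B\<close> show "a * f \<in> {x \<in> ?B. ?L x 0 = 0}"
        by (simp add: mult_closed)
    qed (auto simp: zero_closed add_closed lookup_add)
    then have "I \<subseteq> {x \<in> ?B. ?L x 0 = 0}"
      unfolding I_def irrelevant_ideal_def
    proof (rule R.genideal_minimal)
      show "(\<Union>d\<in>{1..}. ?G d) \<subseteq> {x \<in> ?B. ?L x 0 = 0}"
      proof
        fix x assume "x \<in> (\<Union>d\<in>{1..}. ?G d)"
        then obtain d where d: "d \<ge> 1" "x \<in> ?G d" by auto
        then have "0 \<notin> Poly_Mapping.keys x"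
          using keyG(2)[of 0 x d] by auto
        then show "x \<in> {x \<in> ?B. ?L x 0 = 0}"
          using G_closed[OF d(2)] by (simp add: in_keys_iff)
      qed
    qed
    then have "1 \<notin> I"
      by (auto simp: lookup_one)
    obtain b \<phi> \<epsilon> where "linear_free_resolution ?R ?G (quot_module ?R I) (quot_grading ?R ?G I) b \<phi> \<epsilon>"
      using koszul by (auto simp: koszul_def has_linear_free_resolution_def I_def)
    note res = this[unfolded linear_free_resolution_def]
    have fc: "carrier (free_module ?R n) = {..<n} \<rightarrow>\<^sub>E ?B" for n
      by (simp add: free_module_def)
    have \<epsilon>: "\<epsilon> \<in> module_homs ?R (free_module ?R (b 0)) (quot_module ?R I)"
      using res by (simp add: graded_module_homs_def)
    have \<phi>: "\<phi> i \<in> module_homs ?R (free_module ?R (b (Suc i))) (free_module ?R (b i))" for i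
      using res by (simp add: graded_module_homs_def)
    have \<phi>_closed: "\<phi> 0 z \<in> {..<b 0} \<rightarrow>\<^sub>E ?B" if "z \<in> {..<b (Suc 0)} \<rightarrow>\<^sub>E ?B" for z
      using \<phi>[of 0] that unfolding module_homs_def hom_def by (auto simp: fc simp del: PiE_iff)
    have \<phi>_unit: "\<phi> i (free_unit (b (Suc i)) k) j \<in> ?G 1" if "j < b i" for i k j
    proof -
      have "\<phi> i ` free_grading ?R ?G (Suc i) (b (Suc i)) (Suc i) \<subseteq> free_grading ?R ?G i (b i) (Suc i)"
        using res by (simp add: graded_module_homs_def)
      then have "\<phi> i (free_unit (b (Suc i)) k) \<in> free_grading ?R ?G i (b i) (Suc i)"
        using free_unit_grading by blast
      then show ?thesis
        using that by (auto simp: free_grading_def)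
    qed
    \<comment> \<open>The augmentation maps onto a nonzero module, so coordinate 0 exists. The
      functional below uses only this coordinate, whatever the rank is.\<close>
    have "b 0 \<noteq> 0"
    proof
      assume "b 0 = 0"
      have "I +>\<^bsub>?R\<^esub> 1 \<in> carrier (quot_module ?R I)" "I +>\<^bsub>?R\<^esub> 0 \<in> carrier (quot_module ?R I)"
        using R.a_rcosetsI[OF I.a_subset] one_closed zero_closed by (simp_all add: quot_module_def FactRing_def)
      then have "I +>\<^bsub>?R\<^esub> 1 \<in> \<epsilon> ` ({..<0::nat} \<rightarrow>\<^sub>E ?B)" "I +>\<^bsub>?R\<^esub> 0 \<in> \<epsilon> ` ({..<0::nat} \<rightarrow>\<^sub>E ?B)"
        using res unfolding fc \<open>b 0 = 0\<close> by auto
      then have "I +>\<^bsub>?R\<^esub> 1 = I +>\<^bsub>?R\<^esub> 0" by auto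
      also have "\<dots> = I"
        using I.a_rcos_const[OF I.zero_closed] by simp
      finally show False
        using I.a_rcos_self[of 1] one_closed \<open>1 \<notin> I\<close> by simp
    qed
    let ?n = "b (Suc 0)"
    let ?e = "free_unit (b 0) 0 :: nat \<Rightarrow> (nat \<times> nat) \<Rightarrow>\<^sub>0 'k"
    \<comment> \<open>A monomial of degree one annihilates the residue field, so this multiple of
      the basis vector \<open>?e\<close> lies in the kernel of \<open>\<epsilon>\<close> and lifts
      through \<open>\<phi> 0\<close>.\<close>
    have "\<exists>y \<in> {..<?n} \<rightarrow>\<^sub>E ?B. \<phi> 0 y = (\<lambda>j\<in>{..<b 0}. monomial a * ?e j)" if a: "a \<in> S" "fst a = 1" for a
    proof -
      have mB: "monomial a \<in> ?B" using monomial_mem[OF a(1)] .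
      define v where "v = (\<lambda>j\<in>{..<b 0}. monomial a * ?e j)"
      have v: "v \<in> {..<b 0} \<rightarrow>\<^sub>E ?B"
        using mB by (auto simp: v_def free_unit_def zero_closed)
      have "\<epsilon> ?e \<in> carrier (quot_module ?R I)"
        using \<epsilon> free_unit_closed[of "b 0" 0] by (auto simp: module_homs_def hom_def fc)
      then obtain c where c: "c \<in> ?B" "\<epsilon> ?e = I +>\<^bsub>?R\<^esub> c"
        by (auto simp: quot_module_def FactRing_def A_RCOSETS_def')
      have "\<epsilon> v = monomial a \<odot>\<^bsub>quot_module ?R I\<^esub> \<epsilon> ?e"
        using \<epsilon> mB free_unit_closed[of "b 0" 0] unfolding module_homs_def fc v_def
        by (auto simp: free_module_def)
      also have "\<dots> = I +>\<^bsub>?R\<^esub> (monomial a * c)"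
        using mB c I.rcoset_mult_add[of "monomial a" c] by (simp add: quot_module_def FactRing_def)
      also have "\<dots> = I"
        using I.I_r_closed[of "monomial a" c] monomial_I[OF a] c I.a_rcos_const by simp
      finally have "v \<in> a_kernel (free_module ?R (b 0)) (quot_module ?R I) \<epsilon>"
        using v by (simp add: a_kernel_def' fc quot_module_def FactRing_def)
      then have "v \<in> \<phi> 0 ` ({..<?n} \<rightarrow>\<^sub>E ?B)"
        using res by (simp add: fc)
      then show ?thesis by (auto simp: v_def)
    qed
    from this[OF p] this[OF less.prems(1,3)] obtain yp yq where
      yp: "yp \<in> {..<?n} \<rightarrow>\<^sub>E ?B" "\<phi> 0 yp = (\<lambda>j\<in>{..<b 0}. monomial p * ?e j)" and
      yq: "yq \<in> {..<?n} \<rightarrow>\<^sub>E ?B" "\<phi> 0 yq = (\<lambda>j\<in>{..<b 0}. monomial q * ?e j)"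
      by blast
    have ypB: "yp j \<in> ?B" "yq j \<in> ?B" if "j < ?n" for j
      using yp yq that by auto
    define C where "C j = \<phi> 0 (free_unit ?n j) 0" for j
    have CG: "C j \<in> ?G 1" for j
      unfolding C_def using \<phi>_unit[of 0 0] \<open>b 0 \<noteq> 0\<close> by simp
    have expand0: "\<phi> 0 z i = (\<Sum>j<?n. z j * \<phi> 0 (free_unit ?n j) i)"
      if "z \<in> {..<?n} \<rightarrow>\<^sub>E ?B" "i < b 0" for z i
      using module_homs_expand[OF \<phi> that] .
    \<comment> \<open>Both terms have the same image under \<open>\<phi> 0\<close>, because
      \<open>p + t = q + s\<close>.\<close>
    define w where "w = (\<lambda>j\<in>{..<?n}. monomial t * yp j - monomial s * yq j)"
    have w: "w \<in> {..<?n} \<rightarrow>\<^sub>E ?B"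
      using ypB tS less.prems(2) by (auto simp: w_def intro!: diff_closed mult_closed monomial_mem)
    have "\<phi> 0 w = (\<lambda>i\<in>{..<b 0}. 0)"
    proof
      fix i
      show "\<phi> 0 w i = (\<lambda>i\<in>{..<b 0}. 0) i"
      proof (cases "i < b 0")
        case True
        have "\<phi> 0 w i = monomial t * \<phi> 0 yp i - monomial s * \<phi> 0 yq i"
          unfolding expand0[OF w True] expand0[OF yp(1) True] expand0[OF yq(1) True]
          by (simp add: w_def left_diff_distrib sum_subtractf sum_distrib_left mult.assoc)
        also have "\<dots> = (monomial t * monomial p) * ?e i - (monomial s * monomial q) * ?e i"
          using True by (simp add: yp yq mult.assoc)
        also have "monomial t * monomial p = (monomial s * monomial q :: (nat \<times> nat) \<Rightarrow>\<^sub>0 'k)"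
          using tt(2) by (simp add: monomial_def mult_single add.commute)
        finally show ?thesis using True by simp
      next
        case False
        then show ?thesis
          using \<phi>_closed[OF w] by (auto simp: PiE_iff extensional_def)
      qed
    qed
    then have "w \<in> a_kernel (free_module ?R ?n) (free_module ?R (b 0)) (\<phi> 0)"
      using w by (simp add: a_kernel_def' fc) (simp add: free_module_def)
    moreover have "\<phi> (Suc 0) ` ({..<b (Suc (Suc 0))} \<rightarrow>\<^sub>E ?B) = a_kernel (free_module ?R ?n) (free_module ?R (b 0)) (\<phi> 0)"
      using res by (simp only: fc)
    note im = this
    ultimately obtain f where f: "f \<in> {..<b (Suc (Suc 0))} \<rightarrow>\<^sub>E ?B" "w = \<phi> (Suc 0) f"
      by auto
    let ?n2 = "b (Suc (Suc 0))"
    define D where "D k = \<phi> (Suc 0) (free_unit ?n2 k)" for k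
    have DG: "D k j \<in> ?G 1" if "j < ?n" for k j
      unfolding D_def using \<phi>_unit that by blast
    have D0: "(\<Sum>j<?n. D k j * C j) = 0" for k
    proof -
      have "D k \<in> a_kernel (free_module ?R ?n) (free_module ?R (b 0)) (\<phi> 0)"
        unfolding im[symmetric] D_def using free_unit_closed by blast
      then have "D k \<in> {..<?n} \<rightarrow>\<^sub>E ?B" "\<phi> 0 (D k) = (\<lambda>i\<in>{..<b 0}. 0)"
        unfolding a_kernel_def' fc by (auto simp: free_module_def)
      with expand0[of "D k" 0] show ?thesis
        using \<open>b 0 \<noteq> 0\<close> by (simp add: C_def)
    qed
    \<comment> \<open>The functional weights the coefficient of \<open>t\<close> in coordinate
      \<open>j\<close> by the coefficient of \<open>p\<close> in the linear form \<open>C j\<close>.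
      The part of \<open>w\<close> with \<open>yq\<close> has no key \<open>t\<close>, which would
      force \<open>t = s\<close> and \<open>q = p\<close>. The part with \<open>yp\<close> leaves
      the coefficient of \<open>p\<close> in \<open>\<phi> 0 yp 0\<close>, that is, in
      \<open>monomial p\<close>.\<close>
    have "(\<Sum>j<?n. ?L (w j) t * ?L (C j) p) = 1"
    proof -
      have "?L (w j) t = ?L (yp j) 0" if j: "j < ?n" for j
      proof -
        have "?L (monomial t * yp j) (t + 0) = ?L (monomial t) t * ?L (yp j) 0"
          by (rule lookup_times_unique) (simp add: monomial_def)
        moreover have "t \<notin> Poly_Mapping.keys (monomial s * yq j)"
        proof
          assume "t \<in> Poly_Mapping.keys (monomial s * yq j)"
          then obtain a where a: "a \<in> Poly_Mapping.keys (yq j)" "t = a + s"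
            by (auto simp: mult.commute[of "monomial s"] keys_times_monomial)
          then have "fst a = 0"
            using e by (simp add: t_def prod_eq_iff)
          then have "t = s"
            using deg_zero[OF keyS[OF a(1) ypB(2)[OF j]]] a(2) by simp
          with tt(2) \<open>q \<noteq> p\<close> show False by simp
        qed
        ultimately show ?thesis
          using j by (simp add: w_def lookup_minus in_keys_iff) (simp add: monomial_def)
      qed
      then have "(\<Sum>j<?n. ?L (w j) t * ?L (C j) p) = (\<Sum>j<?n. ?L (yp j) 0 * ?L (C j) p)"
        by simp
      also have "\<dots> = (\<Sum>j<?n. ?L (yp j * C j) p)"
      proof (intro sum.cong refl)
        fix j assume j: "j \<in> {..<?n}"
        have "?L (yp j * C j) (0 + p) = ?L (yp j) 0 * ?L (C j) p"
        proof (rule lookup_times_unique)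
          fix x y assume x: "x \<in> Poly_Mapping.keys (yp j)" and y: "y \<in> Poly_Mapping.keys (C j)" and xy: "x + y = 0 + p"
          have "fst x = 0"
            using arg_cong[OF xy, of fst] keyG(2)[OF y CG] p(2) by simp
          then have "x = 0"
            using deg_zero keyS[OF x ypB(1)] j by blast
          with xy show "x = 0 \<and> y = p" by simp
        qed
        then show "?L (yp j) 0 * ?L (C j) p = ?L (yp j * C j) p" by simp
      qed
      also have "\<dots> = ?L (\<phi> 0 yp 0) p"
        using \<open>b 0 \<noteq> 0\<close> by (simp add: expand0[OF yp(1)] C_def lookup_sum)
      also have "\<dots> = 1"
        using \<open>b 0 \<noteq> 0\<close> by (simp add: yp(2) free_unit_def) (simp add: monomial_def)
      finally show ?thesis .
    qed
    \<comment> \<open>By \<open>low\<close> the coefficient of \<open>t\<close> in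
      \<open>f k * D k j\<close> factors, with \<open>D k j\<close> taken at \<open>p\<close>. By
      \<open>rigid\<close> the remaining sum over \<open>j\<close> is the coefficient of
      \<open>p + p\<close> in the relation \<open>D0\<close>, hence 0.\<close>
    moreover have "(\<Sum>j<?n. ?L (w j) t * ?L (C j) p) = 0"
    proof -
      have wL: "?L (w j) t = (\<Sum>k<?n2. ?L (f k) t' * ?L (D k j) p)" if j: "j < ?n" for j
      proof -
        have "w j = (\<Sum>k<?n2. f k * D k j)"
          unfolding f(2) D_def by (rule module_homs_expand[OF \<phi> f(1) j])
        then have "?L (w j) t = (\<Sum>k<?n2. ?L (f k * D k j) (t' + p))"
          by (simp add: lookup_sum tt(1))
        also have "\<dots> = (\<Sum>k<?n2. ?L (f k) t' * ?L (D k j) p)"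
        proof (intro sum.cong refl lookup_times_unique)
          fix k x y
          assume k: "k \<in> {..<?n2}" and x: "x \<in> Poly_Mapping.keys (f k)" and y: "y \<in> Poly_Mapping.keys (D k j)"
            and xy: "x + y = t' + p"
          have "x \<in> S" using keyS[OF x] f(1) k by auto
          moreover have "y \<in> S" "fst y = 1" using keyG[OF y DG[OF j]] .
          ultimately have "y = p"
            using low[of y x] xy tt(1) by (simp add: add.commute)
          with xy show "x = t' \<and> y = p" by simp
        qed
        finally show ?thesis .
      qed
      have "(\<Sum>j<?n. ?L (w j) t * ?L (C j) p) = (\<Sum>j<?n. \<Sum>k<?n2. ?L (f k) t' * (?L (D k j) p * ?L (C j) p))"
        by (simp add: wL sum_distrib_right mult.assoc)
      also have "\<dots> = (\<Sum>k<?n2. ?L (f k) t' * (\<Sum>j<?n. ?L (D k j) p * ?L (C j) p))"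
        by (subst sum.swap) (simp add: sum_distrib_left)
      also have "\<dots> = 0"
      proof (intro sum.neutral ballI)
        fix k
        have "(\<Sum>j<?n. ?L (D k j) p * ?L (C j) p) = (\<Sum>j<?n. ?L (D k j * C j) (p + p))"
        proof (intro sum.cong refl lookup_times_unique[symmetric])
          fix j x y assume j: "j \<in> {..<?n}" and x: "x \<in> Poly_Mapping.keys (D k j)"
            and y: "y \<in> Poly_Mapping.keys (C j)" and xy: "x + y = p + p"
          have "x = p"
            using rigid[of x y] keyG[OF x DG] keyG[OF y CG] j xy by simp
          with xy show "x = p \<and> y = p" by simp
        qed
        also have "\<dots> = ?L (\<Sum>j<?n. D k j * C j) (p + p)"
          by (simp add: lookup_sum)
        finally show "?L (f k) t' * (\<Sum>j<?n. ?L (D k j) p * ?L (C j) p) = 0"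
          by (simp add: D0)
      qed
      finally show ?thesis .
    qed
    ultimately show False by simp
  qed
qed

end

section \<open>Coordinate rings of monomial curves\<close>

text \<open>The linear map induced by a map of exponents. The parametrization of the curve and the
  map onto the monoid algebra both have this form, which makes their kernels comparable.\<close>

definition monomial_hom :: "('a \<Rightarrow> 'b) \<Rightarrow> ('a \<Rightarrow>\<^sub>0 'k::field) \<Rightarrow> 'b \<Rightarrow>\<^sub>0 'k"
  where "monomial_hom e p = (\<Sum>a\<in>Poly_Mapping.keys p. Poly_Mapping.single (e a) (Poly_Mapping.lookup p a))"

lemma monomial_hom_superset:
  "finite A \<Longrightarrow> Poly_Mapping.keys p \<subseteq> A \<Longrightarrow>
    monomial_hom e p = (\<Sum>a\<in>A. Poly_Mapping.single (e a) (Poly_Mapping.lookup p a))"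
  unfolding monomial_hom_def by (rule sum.mono_neutral_left) (auto simp: in_keys_iff)

lemma monomial_hom_single [simp]: "monomial_hom e (Poly_Mapping.single a c) = Poly_Mapping.single (e a) c"
  by (simp add: monomial_hom_superset[of "{a}"])

lemma monomial_hom_add: "monomial_hom e (p + q) = monomial_hom e p + monomial_hom e q"
proof -
  let ?A = "Poly_Mapping.keys p \<union> Poly_Mapping.keys q"
  have "Poly_Mapping.keys (p + q) \<subseteq> ?A"
    by (rule Poly_Mapping.keys_add)
  then show ?thesis
    by (simp add: monomial_hom_superset[of ?A] lookup_add single_add sum.distrib)
qed

lemma monomial_hom_sum: "monomial_hom e (sum f I) = (\<Sum>i\<in>I. monomial_hom e (f i))"
  by (induction I rule: infinite_finite_induct) (auto simp: monomial_hom_add, auto simp: monomial_hom_def)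

lemma monomial_hom_mult:
  assumes "\<And>a b. e (a + b) = e a + e b"
  shows "monomial_hom e (p * q) = monomial_hom e p * monomial_hom e q"
proof -
  have pq: "p * q = (\<Sum>a\<in>Poly_Mapping.keys p. \<Sum>b\<in>Poly_Mapping.keys q.
      Poly_Mapping.single (a + b) (Poly_Mapping.lookup p a * Poly_Mapping.lookup q b))"
    by (subst poly_mapping_sum_single[of p], subst poly_mapping_sum_single[of q])
      (simp only: sum_product mult_single)
  have "monomial_hom e (p * q) = (\<Sum>a\<in>Poly_Mapping.keys p. \<Sum>b\<in>Poly_Mapping.keys q.
      Poly_Mapping.single (e a + e b) (Poly_Mapping.lookup p a * Poly_Mapping.lookup q b))"
    unfolding pq by (simp add: monomial_hom_sum assms)
  then show ?thesis
    by (simp only: monomial_hom_def sum_product mult_single)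
qed

lemma lookup_monomial_hom:
  "Poly_Mapping.lookup (monomial_hom e p) s = (\<Sum>a | a \<in> Poly_Mapping.keys p \<and> e a = s. Poly_Mapping.lookup p a)"
  unfolding monomial_hom_def
  by (simp add: lookup_sum lookup_single when_def sum.If_cases Int_def conj_commute)

lemma keys_monomial_hom: "Poly_Mapping.keys (monomial_hom e p) \<subseteq> e ` Poly_Mapping.keys p"
proof
  fix s assume "s \<in> Poly_Mapping.keys (monomial_hom e p)"
  then have "{a \<in> Poly_Mapping.keys p. e a = s} \<noteq> {}"
    unfolding in_keys_iff lookup_monomial_hom by (metis sum.empty)
  then show "s \<in> e ` Poly_Mapping.keys p"
    by auto
qed

text \<open>The condition only sees which keys have equal values under \<open>e\<close>, so exponent
  maps with the same fibres have the same kernel.\<close>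

lemma monomial_hom_eq_zero_iff:
  "monomial_hom e p = 0 \<longleftrightarrow> (\<forall>b\<in>Poly_Mapping.keys p.
    (\<Sum>a | a \<in> Poly_Mapping.keys p \<and> e a = e b. Poly_Mapping.lookup p a) = 0)"
proof
  assume "monomial_hom e p = 0"
  then show "\<forall>b\<in>Poly_Mapping.keys p. (\<Sum>a | a \<in> Poly_Mapping.keys p \<and> e a = e b. Poly_Mapping.lookup p a) = 0"
    by (simp add: lookup_monomial_hom[symmetric])
next
  assume *: "\<forall>b\<in>Poly_Mapping.keys p. (\<Sum>a | a \<in> Poly_Mapping.keys p \<and> e a = e b. Poly_Mapping.lookup p a) = 0"
  show "monomial_hom e p = 0"
  proof (rule poly_mapping_eqI)
    fix s
    show "Poly_Mapping.lookup (monomial_hom e p) s = Poly_Mapping.lookup 0 s"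
    proof (cases "s \<in> e ` Poly_Mapping.keys p")
      case True
      then show ?thesis using * by (auto simp: lookup_monomial_hom)
    next
      case False
      then show ?thesis using keys_monomial_hom[of e p] by (auto simp: in_keys_iff)
    qed
  qed
qed

lemma image_monomial_hom:
  "monomial_hom e ` {p. Poly_Mapping.keys p \<subseteq> A} = {q :: 'b \<Rightarrow>\<^sub>0 'k::field. Poly_Mapping.keys q \<subseteq> e ` A}"
proof (intro equalityI subsetI)
  fix q :: "'b \<Rightarrow>\<^sub>0 'k" assume q: "q \<in> {q. Poly_Mapping.keys q \<subseteq> e ` A}"
  define p where "p = (\<Sum>s\<in>Poly_Mapping.keys q. Poly_Mapping.single (inv_into A e s) (Poly_Mapping.lookup q s))"
  have mem: "s \<in> e ` A" if "s \<in> Poly_Mapping.keys q" for s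
    using q that by auto
  have "monomial_hom e p = (\<Sum>s\<in>Poly_Mapping.keys q. Poly_Mapping.single s (Poly_Mapping.lookup q s))"
    unfolding p_def by (simp add: monomial_hom_sum f_inv_into_f[OF mem])
  also have "\<dots> = q"
    by (rule poly_mapping_sum_single[symmetric])
  finally have "q = monomial_hom e p" ..
  moreover have "Poly_Mapping.keys p \<subseteq> A"
  proof -
    have "Poly_Mapping.keys p \<subseteq> (\<Union>s\<in>Poly_Mapping.keys q. {inv_into A e s})"
      unfolding p_def by (rule order.trans[OF keys_sum]) auto
    also have "\<dots> \<subseteq> A"
      using mem by (auto intro: inv_into_into)
    finally show ?thesis .
  qed
  ultimately show "q \<in> monomial_hom e ` {p. Poly_Mapping.keys p \<subseteq> A}"
    by blast
next
  fix q :: "'b \<Rightarrow>\<^sub>0 'k" assume "q \<in> monomial_hom e ` {p. Poly_Mapping.keys p \<subseteq> A}"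
  then show "q \<in> {q. Poly_Mapping.keys q \<subseteq> e ` A}"
    using keys_monomial_hom[of e] by blast
qed

section \<open>Degree, weight and the monoid of the curve\<close>

definition weight :: "(nat \<Rightarrow> nat) \<Rightarrow> (nat \<Rightarrow>\<^sub>0 nat) \<Rightarrow> nat"
  where "weight f a = (\<Sum>i\<in>Poly_Mapping.keys a. Poly_Mapping.lookup a i * f i)"

lemma weight_superset:
  "finite X \<Longrightarrow> Poly_Mapping.keys a \<subseteq> X \<Longrightarrow> weight f a = (\<Sum>i\<in>X. Poly_Mapping.lookup a i * f i)"
  unfolding weight_def by (rule sum.mono_neutral_left) (auto simp: in_keys_iff)

lemma weight_add: "weight f (a + b) = weight f a + weight f b"
proof -
  let ?A = "Poly_Mapping.keys a \<union> Poly_Mapping.keys b"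
  have "Poly_Mapping.keys (a + b) \<subseteq> ?A"
    by (rule Poly_Mapping.keys_add)
  then show ?thesis
    by (simp add: weight_superset[of ?A] lookup_add distrib_right sum.distrib)
qed

lemma mdeg_weight: "mdeg a = weight (\<lambda>_. 1) a"
  by (simp add: mdeg_def weight_def)

definition curve_exponent :: "nat \<Rightarrow> (nat \<Rightarrow> nat) \<Rightarrow> nat \<Rightarrow> nat"
  where "curve_exponent n m i = (if i \<le> n then m i else 0)"

text \<open>The exponents of u and v carry the same information; the degree is chosen as first
  coordinate because it is the grading.\<close>

definition bidegree :: "nat \<Rightarrow> (nat \<Rightarrow> nat) \<Rightarrow> (nat \<Rightarrow>\<^sub>0 nat) \<Rightarrow> nat \<times> nat"
  where "bidegree n m a = (mdeg a, weight (curve_exponent n m) a)"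

definition curve_monoid :: "nat \<Rightarrow> (nat \<Rightarrow> nat) \<Rightarrow> (nat \<times> nat) set"
  where "curve_monoid n m = bidegree n m ` {a. Poly_Mapping.keys a \<subseteq> {1..n + 1}}"

lemma bidegree_add: "bidegree n m (a + b) = bidegree n m a + bidegree n m b"
  by (simp add: bidegree_def mdeg_weight weight_add)

lemma graded_monoid_curve: "graded_monoid (curve_monoid n m)"
proof
  show "0 \<in> curve_monoid n m"
    unfolding curve_monoid_def
    by (rule image_eqI[of _ _ 0]) (auto simp: bidegree_def mdeg_def weight_def zero_prod_def)
  show "s + t \<in> curve_monoid n m" if st: "s \<in> curve_monoid n m" "t \<in> curve_monoid n m" for s t
  proof -
    obtain a b where "s = bidegree n m a" "t = bidegree n m b"
      "Poly_Mapping.keys a \<subseteq> {1..n + 1}" "Poly_Mapping.keys b \<subseteq> {1..n + 1}"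
      using st unfolding curve_monoid_def by blast
    then show ?thesis
      unfolding curve_monoid_def
      by (intro image_eqI[of _ _ "a + b"]) (auto simp: bidegree_add dest: Poly_Mapping.keys_add[THEN subsetD])
  qed
  show "s = 0" if s: "s \<in> curve_monoid n m" "fst s = 0" for s
  proof -
    obtain a where a: "s = bidegree n m a"
      using s(1) unfolding curve_monoid_def by blast
    with s(2) have "Poly_Mapping.lookup a i = 0" for i
      by (cases "i \<in> Poly_Mapping.keys a") (simp_all add: bidegree_def mdeg_def in_keys_iff)
    then have "a = 0"
      by (simp add: poly_mapping_eqI)
    then show ?thesis
      by (simp add: a bidegree_def mdeg_def weight_def zero_prod_def)
  qed
qed

lemma mpoly_ring_subset_ring: "mpoly_ring X = subset_ring {p. \<forall>a\<in>Poly_Mapping.keys p. Poly_Mapping.keys a \<subseteq> X}"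
  by (simp add: mpoly_ring_def subset_ring_def)

lemma carrier_mpoly_ring: "carrier (mpoly_ring X) = {p. Poly_Mapping.keys p \<subseteq> {a. Poly_Mapping.keys a \<subseteq> X}}"
  by (auto simp: mpoly_ring_def)

lemma cring_mpoly_ring: "cring (mpoly_ring X :: 'k::field mpoly ring)"
proof -
  have "comm_subring {p :: 'k mpoly. \<forall>a\<in>Poly_Mapping.keys p. Poly_Mapping.keys a \<subseteq> X}"
  proof
    fix p q :: "'k mpoly"
    assume *: "p \<in> {p. \<forall>a\<in>Poly_Mapping.keys p. Poly_Mapping.keys a \<subseteq> X}"
      "q \<in> {p. \<forall>a\<in>Poly_Mapping.keys p. Poly_Mapping.keys a \<subseteq> X}"
    then show "p + q \<in> {p. \<forall>a\<in>Poly_Mapping.keys p. Poly_Mapping.keys a \<subseteq> X}"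
      using Poly_Mapping.keys_add[of p q] by blast
    show "p * q \<in> {p. \<forall>a\<in>Poly_Mapping.keys p. Poly_Mapping.keys a \<subseteq> X}"
    proof (intro CollectI ballI)
      fix k assume "k \<in> Poly_Mapping.keys (p * q)"
      then obtain a b where "a \<in> Poly_Mapping.keys p" "b \<in> Poly_Mapping.keys q" "k = a + b"
        using keys_mult[of p q] by blast
      then show "Poly_Mapping.keys k \<subseteq> X"
        using * Poly_Mapping.keys_add[of a b] by blast
    qed
  qed auto
  then show ?thesis
    unfolding mpoly_ring_subset_ring by (rule comm_subring.cring_subset_ring)
qed

lemma mvar_power: "mvar i ^ k = Poly_Mapping.single (Poly_Mapping.single i k) 1"
  by (induction k) (auto simp: mvar_def mult_single single_add[symmetric])

text \<open>With exponent 0 for the last variable every variable goes to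
  \<open>u^c v^(m n - c)\<close>, where \<open>c\<close> is its
  \<open>curve_exponent\<close>.\<close>

lemma mpoly_subst_curve_param:
  fixes p :: "'k::field mpoly"
  shows "mpoly_subst (curve_param n m) p = monomial_hom (\<lambda>a.
    Poly_Mapping.single 0 (weight (curve_exponent n m) a) +
    Poly_Mapping.single 1 (weight (\<lambda>i. m n - curve_exponent n m i) a)) p"
proof -
  have "(curve_param n m i :: 'k mpoly) = mvar 0 ^ curve_exponent n m i * mvar 1 ^ (m n - curve_exponent n m i)" for i
    by (simp add: curve_param_def curve_exponent_def)
  then have "(\<Prod>i\<in>Poly_Mapping.keys a. (curve_param n m i :: 'k mpoly) ^ Poly_Mapping.lookup a i) =
      mvar 0 ^ weight (curve_exponent n m) a * mvar 1 ^ weight (\<lambda>i. m n - curve_exponent n m i) a" for a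
    by (simp add: power_mult_distrib prod.distrib power_mult[symmetric] power_sum weight_def mult.commute)
  then show ?thesis
    by (simp add: mpoly_subst_def monomial_hom_def mvar_power mconst_def mult_single)
qed

text \<open>The exponents of u and v in the image of a monomial add up to \<open>m n\<close> times
  its degree. As \<open>m n\<close> is positive, this pair and the bidegree determine each other, so
  the two exponent maps have the same fibres.\<close>

lemma curve_ideal_eq_kernel:
  assumes m: "\<And>i. i \<in> {1..n} \<Longrightarrow> m i \<le> m n" "0 < m n"
  shows "curve_ideal n m = a_kernel (mpoly_ring {1..n+1})
    (subset_ring (monoid_algebra (curve_monoid n m))) (monomial_hom (bidegree n m))"
proof -
  let ?e = "\<lambda>a. Poly_Mapping.single (0::nat) (weight (curve_exponent n m) a) +
    Poly_Mapping.single 1 (weight (\<lambda>i. m n - curve_exponent n m i) a)"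
  have inj: "?e a = ?e b \<longleftrightarrow> bidegree n m a = bidegree n m b"
    if a: "Poly_Mapping.keys a \<subseteq> {1..n+1}" "Poly_Mapping.keys b \<subseteq> {1..n+1}" for a b
  proof -
    have *: "weight (curve_exponent n m) c + weight (\<lambda>i. m n - curve_exponent n m i) c = mdeg c * m n"
      if c: "Poly_Mapping.keys c \<subseteq> {1..n+1}" for c
    proof -
      have "curve_exponent n m i \<le> m n" if "i \<in> Poly_Mapping.keys c" for i
        using that c m(1)[of i] by (auto simp: curve_exponent_def)
      then show ?thesis
        unfolding weight_def mdeg_def sum.distrib[symmetric] sum_distrib_right
        by (intro sum.cong refl) (simp add: distrib_left[symmetric])
    qed
    have l: "Poly_Mapping.lookup (?e c) 0 = weight (curve_exponent n m) c"
      "Poly_Mapping.lookup (?e c) 1 = weight (\<lambda>i. m n - curve_exponent n m i) c" for c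
      by (simp_all add: lookup_add lookup_single)
    have "?e a = ?e b \<longleftrightarrow> weight (curve_exponent n m) a = weight (curve_exponent n m) b \<and>
        weight (\<lambda>i. m n - curve_exponent n m i) a = weight (\<lambda>i. m n - curve_exponent n m i) b"
      by (metis l)
    also have "\<dots> \<longleftrightarrow> bidegree n m a = bidegree n m b"
      using *[OF a(1)] *[OF a(2)] m(2) unfolding bidegree_def by (metis add_left_cancel mult_cancel2 less_irrefl prod.inject)
    finally show ?thesis .
  qed
  have "mpoly_subst (curve_param n m) p = 0 \<longleftrightarrow> monomial_hom (bidegree n m) p = 0"
    if p: "p \<in> carrier (mpoly_ring {1..n+1})" for p :: "'a mpoly"
  proof -
    have "{a \<in> Poly_Mapping.keys p. ?e a = ?e b} = {a \<in> Poly_Mapping.keys p. bidegree n m a = bidegree n m b}"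
      if "b \<in> Poly_Mapping.keys p" for b
      using inj that p by (auto simp only: carrier_mpoly_ring)
    then show ?thesis
      unfolding mpoly_subst_curve_param monomial_hom_eq_zero_iff by simp
  qed
  then show ?thesis
    by (auto simp: curve_ideal_def a_kernel_def' mpoly_ring_def)
qed

text \<open>The first isomorphism theorem for \<open>monomial_hom (bidegree n m)\<close> matches the
  gradings as well; the two implications use the isomorphism and its inverse.\<close>

lemma koszul_curve_iff:
  assumes m: "\<And>i. i \<in> {1..n} \<Longrightarrow> m i \<le> m n" "0 < m n"
  shows "koszul (curve_ring n m :: 'k::field mpoly set ring) (curve_grading n m) \<longleftrightarrow>
    koszul (subset_ring (monoid_algebra (curve_monoid n m) :: ((nat \<times> nat) \<Rightarrow>\<^sub>0 'k) set)) (monoid_grading (curve_monoid n m))"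
proof -
  interpret graded_monoid "curve_monoid n m" by (rule graded_monoid_curve)
  let ?R = "mpoly_ring {1..n+1} :: 'k mpoly ring"
  let ?S = "subset_ring (monoid_algebra (curve_monoid n m) :: ((nat \<times> nat) \<Rightarrow>\<^sub>0 'k) set)"
  let ?A = "curve_ring n m :: 'k mpoly set ring"
  let ?p = "monomial_hom (bidegree n m) :: 'k mpoly \<Rightarrow> _"
  interpret R: cring ?R by (rule cring_mpoly_ring)
  interpret S: cring ?S by (rule cring_subset_ring)
  have im: "?p ` carrier ?R = carrier ?S"
    unfolding carrier_mpoly_ring image_monomial_hom by (simp add: monoid_algebra_def curve_monoid_def)
  have one: "?p 1 = 1"
    using monomial_hom_single[of "bidegree n m" 0 1]
    by (simp add: bidegree_def mdeg_def weight_def zero_prod_def[symmetric])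
  interpret p: ring_hom_ring ?R ?S ?p
  proof (intro ring_hom_ringI2 ring_hom_memI R.ring_axioms S.ring_axioms)
    show "?p x \<in> carrier ?S" if "x \<in> carrier ?R" for x
      using im that by blast
  qed (simp_all add: mpoly_ring_subset_ring monomial_hom_mult bidegree_add monomial_hom_add one)
  let ?h = "\<lambda>X. the_elem (?p ` X)"
  have J: "curve_ideal n m = a_kernel ?R ?S ?p"
    using m by (rule curve_ideal_eq_kernel)
  have A: "?A = ?R Quot a_kernel ?R ?S ?p"
    by (simp only: curve_ring_def J)
  have h: "?h \<in> ring_iso ?A ?S"
    unfolding A by (rule p.FactRing_iso_set[OF im])
  have ringA: "ring ?A"
    unfolding A by (intro ideal.quotient_is_ring p.kernel_is_ideal)
  have sub: "mpoly_grading {1..n+1} d \<subseteq> carrier ?R" for d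
    by (auto simp: mpoly_grading_def)
  have GA: "curve_grading n m d \<subseteq> carrier ?A" for d
    unfolding curve_grading_def quot_grading_def A J
    using sub[of d] by (auto simp: FactRing_def A_RCOSETS_def')
  have hG: "?h ` curve_grading n m d = monoid_grading (curve_monoid n m) d" for d
  proof -
    have "?h ` curve_grading n m d = ?p ` mpoly_grading {1..n+1} d"
      unfolding curve_grading_def quot_grading_def J image_image
      using sub[of d] by (intro image_cong refl p.the_elem_simp) auto
    also have "mpoly_grading {1..n+1} d =
        {p :: 'k mpoly. Poly_Mapping.keys p \<subseteq> {a. Poly_Mapping.keys a \<subseteq> {1..n+1} \<and> mdeg a = d}}"
      by (auto simp: mpoly_grading_def mpoly_ring_def)
    also have "?p ` \<dots> = monoid_grading (curve_monoid n m) d"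
    proof -
      have "bidegree n m ` {a. Poly_Mapping.keys a \<subseteq> {1..n+1} \<and> mdeg a = d} = {s \<in> curve_monoid n m. fst s = d}"
        unfolding curve_monoid_def by (auto simp: bidegree_def)
      then show ?thesis
        unfolding image_monomial_hom monoid_grading_def by simp
    qed
    finally show ?thesis .
  qed
  let ?k = "inv_into (carrier ?A) ?h"
  have k: "?k \<in> ring_iso ?S ?A"
    by (rule ring_iso_set_sym[OF ringA h])
  have kG: "?k ` monoid_grading (curve_monoid n m) d = curve_grading n m d" for d
    unfolding hG[symmetric] using ring_iso_memE(5)[OF h] GA by (simp add: bij_betw_def inv_into_image_cancel)
  have GS: "monoid_grading (curve_monoid n m) d \<subseteq> carrier ?S" for d
    using G_subset by simp
  show ?thesis
  proof
    show "koszul ?S (monoid_grading (curve_monoid n m))" if "koszul ?A (curve_grading n m)"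
      using GA hG that by (rule koszul_ring_iso[OF ringA S.ring_axioms h])
    show "koszul ?A (curve_grading n m)" if "koszul ?S (monoid_grading (curve_monoid n m))"
      using GS kG that by (rule koszul_ring_iso[OF S.ring_axioms ringA k])
  qed
qed

section \<open>The case of four variables and the necessary condition\<close>

lemma curve_monoid_3:
  "(d, s) \<in> curve_monoid 3 m \<longleftrightarrow>
    (\<exists>a b c e. d = a + b + c + e \<and> s = a * m 1 + b * m 2 + c * m 3)"
proof
  have 4: "{1..3 + 1} = {1, 2, 3, 4::nat}" by auto
  assume "(d, s) \<in> curve_monoid 3 m"
  then obtain f where f: "Poly_Mapping.keys f \<subseteq> {1..3 + 1}" "(d, s) = bidegree 3 m f"
    by (auto simp: curve_monoid_def)
  from f(1) have "mdeg f = Poly_Mapping.lookup f 1 + Poly_Mapping.lookup f 2 + Poly_Mapping.lookup f 3 + Poly_Mapping.lookup f 4"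
    "weight (curve_exponent 3 m) f = Poly_Mapping.lookup f 1 * m 1 + Poly_Mapping.lookup f 2 * m 2 + Poly_Mapping.lookup f 3 * m 3"
    unfolding mdeg_weight 4 by (simp_all add: weight_superset[of "{1, 2, 3, 4}"] curve_exponent_def)
  with f(2) show "\<exists>a b c e. d = a + b + c + e \<and> s = a * m 1 + b * m 2 + c * m 3"
    unfolding bidegree_def by blast
next
  have 4: "{1..3 + 1} = {1, 2, 3, 4::nat}" by auto
  assume "\<exists>a b c e. d = a + b + c + e \<and> s = a * m 1 + b * m 2 + c * m 3"
  then obtain a b c e where d: "d = a + b + c + e" "s = a * m 1 + b * m 2 + c * m 3" by blast
  let ?f = "Poly_Mapping.single 1 a + Poly_Mapping.single 2 b + Poly_Mapping.single 3 c + Poly_Mapping.single (4::nat) e"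
  have "Poly_Mapping.keys ?f \<subseteq> {1..3 + 1}"
    by (auto simp: in_keys_iff lookup_add lookup_single when_def split: if_splits)
  moreover from this have "bidegree 3 m ?f = (d, s)"
    unfolding bidegree_def mdeg_weight 4
    by (simp add: weight_superset[of "{1, 2, 3, 4}"] curve_exponent_def lookup_add lookup_single d)
  ultimately show "(d, s) \<in> curve_monoid 3 m"
    unfolding curve_monoid_def by (metis (mono_tags, lifting) image_eqI mem_Collect_eq)
qed

lemma curve_monoid_3_degree_one:
  "(1, s) \<in> curve_monoid 3 m \<longleftrightarrow> s \<in> {0, m 1, m 2, m 3}"
proof
  assume "(1, s) \<in> curve_monoid 3 m"
  then obtain a b c e where "1 = a + b + c + e" "s = a * m 1 + b * m 2 + c * m 3"
    unfolding curve_monoid_3 by blast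
  then consider "a = 1" "b = 0" "c = 0" | "a = 0" "b = 1" "c = 0" | "a = 0" "b = 0" "c = 1" | "a = 0" "b = 0" "c = 0"
    by (cases a; cases b; cases c) auto
  then show "s \<in> {0, m 1, m 2, m 3}"
    using \<open>s = _\<close> by cases auto
next
  assume "s \<in> {0, m 1, m 2, m 3}"
  moreover have "(1, a * m 1 + b * m 2 + c * m 3) \<in> curve_monoid 3 m" if "a + b + c \<le> 1" for a b c
    unfolding curve_monoid_3 using that
    by (intro exI[of _ a] exI[of _ b] exI[of _ c] exI[of _ "1 - (a + b + c)"]) simp
  from this[of 0 0 0] this[of 1 0 0] this[of 0 1 0] this[of 0 0 1]
  have "(1, 0) \<in> curve_monoid 3 m" "(1, m 1) \<in> curve_monoid 3 m" "(1, m 2) \<in> curve_monoid 3 m" "(1, m 3) \<in> curve_monoid 3 m"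
    by simp_all
  ultimately show "(1, s) \<in> curve_monoid 3 m"
    by auto
qed

context
  fixes m :: "nat \<Rightarrow> nat"
  assumes m: "0 < m 1" "m 1 < m 2" "m 2 < m 3"
begin

interpretation graded_monoid "curve_monoid 3 m"
  by (rule graded_monoid_curve)

text \<open>Contrapositive of \<open>koszul_rigid\<close> with \<open>d = q\<close>: the multiple
  \<open>(q, q * p)\<close> of \<open>(1, p)\<close> also splits off \<open>(1, q)\<close>, so
  \<open>(2, 2 * p)\<close> must have a second decomposition.\<close>

lemma koszul_double:
  fixes p q d :: nat
  assumes k: "koszul (subset_ring (monoid_algebra (curve_monoid 3 m) :: ((nat \<times> nat) \<Rightarrow>\<^sub>0 'k::field) set)) (monoid_grading (curve_monoid 3 m))"
    and p: "p \<in> {m 1, m 2, m 3}" and q: "q \<in> {m 1, m 2, m 3}" "p < q"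
  shows "\<exists>x\<in>{0, m 1, m 2, m 3}. \<exists>y\<in>{0, m 1, m 2, m 3}. x \<noteq> p \<and> x + y = p + p"
proof (rule ccontr)
  assume *: "\<not> ?thesis"
  have pS: "(1, p) \<in> curve_monoid 3 m" "(1, q) \<in> curve_monoid 3 m"
    using p q unfolding curve_monoid_3_degree_one by auto
  have mult: "(e, e * t) \<in> curve_monoid 3 m" if "(1, t) \<in> curve_monoid 3 m" for e t
  proof (induction e)
    case 0
    then show ?case using zero_mem by (simp add: zero_prod_def)
  next
    case (Suc e)
    then show ?case using add_mem[OF that Suc] by simp
  qed
  have "(1, 0) \<in> curve_monoid 3 m"
    unfolding curve_monoid_3_degree_one by simp
  \<comment> \<open>What remains of \<open>(q, q * p)\<close> after removing \<open>(1, q)\<close>: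
    \<open>p - 1\<close> copies of \<open>(1, q)\<close> and \<open>q - p\<close> copies of
    \<open>(1, 0)\<close>.\<close>
  from add_mem[OF mult[OF pS(2), of "p - 1"] mult[OF this, of "q - p"]]
  have s: "(p - 1 + (q - p), (p - 1) * q) \<in> curve_monoid 3 m"
    by simp
  have "p > 0" using p m by auto
  then have eq: "(1, q) + (p - 1 + (q - p), (p - 1) * q) = (q, q * snd (1::nat, p))"
    using q(2) by (cases p) auto
  have "(1::nat, q) = (1, p)"
  proof (rule koszul_rigid[OF k pS(1) _ _ pS(2) s _ eq])
    fix u v assume u: "u \<in> curve_monoid 3 m" "v \<in> curve_monoid 3 m" "fst u = 1" "u + v = (1, p) + (1, p)"
    then obtain x y where uv: "u = (1, x)" "v = (1, y)" "x + y = p + p"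
      by (cases u; cases v) auto
    with u have "x \<in> {0, m 1, m 2, m 3}" "y \<in> {0, m 1, m 2, m 3}"
      by (simp_all only: curve_monoid_3_degree_one)
    with * uv show "u = (1, p)" by blast
  qed auto
  with q(2) show False by simp
qed

end

section \<open>The three exceptional monoids and their filtrations\<close>

lemma curve_monoid_step:
  "(\<exists>t\<in>S. (d, e) + (1, j) = (1, i) + t) \<longleftrightarrow> i \<le> e + j \<and> (d, e + j - i) \<in> S"
  "(\<exists>t\<in>S. (d, e) = (1, i) + t) \<longleftrightarrow> 1 \<le> d \<and> i \<le> e \<and> (d - 1, e - i) \<in> S"
  for S :: "(nat \<times> nat) set"
proof -
  have "t = (d, e + j - i)" "i \<le> e + j" if "(d, e) + (1, j) = (1, i) + t" for t
    using that by (cases t; simp)+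
  then show "(\<exists>t\<in>S. (d, e) + (1, j) = (1, i) + t) \<longleftrightarrow> i \<le> e + j \<and> (d, e + j - i) \<in> S"
    by (auto 0 3 intro!: bexI[of _ "(d, e + j - i)"])
  have "t = (d - 1, e - i)" "i \<le> e" "1 \<le> d" if "(d, e) = (1, i) + t" for t
    using that by (cases t; simp)+
  then show "(\<exists>t\<in>S. (d, e) = (1, i) + t) \<longleftrightarrow> 1 \<le> d \<and> i \<le> e \<and> (d - 1, e - i) \<in> S"
    by (auto 0 3 intro!: bexI[of _ "(d - 1, e - i)"])
qed

lemma curve_monoid_123:
  assumes "m 1 = 1" "m 2 = 2" "m 3 = 3"
  shows "(d, s) \<in> curve_monoid 3 m \<longleftrightarrow> s \<le> 3 * d"
proof
  assume "(d, s) \<in> curve_monoid 3 m"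
  then obtain a b c e where "d = a + b + c + e" "s = a * 1 + b * 2 + c * 3"
    unfolding curve_monoid_3 assms by blast
  then show "s \<le> 3 * d" by simp
next
  assume s: "s \<le> 3 * d"
  define k where "k = s div 3"
  consider "s = 3 * k" | "s = 3 * k + 1" | "s = 3 * k + 2"
    unfolding k_def by linarith
  then obtain a b where "s = a * 1 + b * 2 + k * 3" "a + b + k \<le> d"
  proof cases
    case 1
    with s that[of 0 0] show ?thesis by auto
  next
    case 2
    with s that[of 1 0] show ?thesis by auto
  next
    case 3
    with s that[of 0 1] show ?thesis by auto
  qed
  then have "d = a + b + k + (d - a - b - k) \<and> s = a * 1 + b * 2 + k * 3" by simp
  then show "(d, s) \<in> curve_monoid 3 m"
    unfolding curve_monoid_3 assms by blast
qed

text \<open>The v-exponents of the four generators are 4, 3, 2 and 0, so the total v-exponent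
  \<open>4 * d - s\<close> takes every value up to \<open>4 * d\<close> except 1.\<close>

lemma curve_monoid_124:
  assumes "m 1 = 1" "m 2 = 2" "m 3 = 4"
  shows "(d, s) \<in> curve_monoid 3 m \<longleftrightarrow> s \<le> 4 * d \<and> s + 1 \<noteq> 4 * d"
proof
  assume "(d, s) \<in> curve_monoid 3 m"
  then obtain a b c e where "d = a + b + c + e" "s = a * 1 + b * 2 + c * 4"
    unfolding curve_monoid_3 assms by blast
  then show "s \<le> 4 * d \<and> s + 1 \<noteq> 4 * d" by presburger
next
  assume s: "s \<le> 4 * d \<and> s + 1 \<noteq> 4 * d"
  define k where "k = s div 4"
  consider "s = 4 * k" | "s = 4 * k + 1" | "s = 4 * k + 2" | "s = 4 * k + 3"
    unfolding k_def by linarith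
  then obtain a b where "s = a * 1 + b * 2 + k * 4" "a + b + k \<le> d"
  proof cases
    case 1
    with s that[of 0 0] show ?thesis by auto
  next
    case 2
    with s that[of 1 0] show ?thesis by auto
  next
    case 3
    with s that[of 0 1] show ?thesis by auto
  next
    case 4
    \<comment> \<open>Remainder 3 needs both generators 1 and 2. The excluded case
      \<open>s + 1 = 4 * d\<close> is the one where only one more generator is available.\<close>
    moreover from this s have "1 + 1 + k \<le> d" by presburger
    ultimately show ?thesis using that[of 1 1] by simp
  qed
  then have "d = a + b + k + (d - a - b - k) \<and> s = a * 1 + b * 2 + k * 4" by simp
  then show "(d, s) \<in> curve_monoid 3 m"
    unfolding curve_monoid_3 assms by blast
qed

text \<open>The mirror image of the monoid for 1, 2, 4: exchanging u and v replaces \<open>s\<close>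
  by \<open>4 * d - s\<close> and moves the gap to \<open>s = 1\<close>.\<close>

lemma curve_monoid_234:
  assumes "m 1 = 2" "m 2 = 3" "m 3 = 4"
  shows "(d, s) \<in> curve_monoid 3 m \<longleftrightarrow> s \<le> 4 * d \<and> s \<noteq> 1"
proof
  assume "(d, s) \<in> curve_monoid 3 m"
  then obtain a b c e where "d = a + b + c + e" "s = a * 2 + b * 3 + c * 4"
    unfolding curve_monoid_3 assms by blast
  then show "s \<le> 4 * d \<and> s \<noteq> 1" by presburger
next
  assume s: "s \<le> 4 * d \<and> s \<noteq> 1"
  define k where "k = s div 4"
  consider "s = 4 * k" | "s = 4 * k + 1" | "s = 4 * k + 2" | "s = 4 * k + 3"
    unfolding k_def by linarith
  then obtain a b c where "s = a * 2 + b * 3 + c * 4" "a + b + c \<le> d"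
  proof cases
    case 1
    with s that[of 0 0 k] show ?thesis by auto
  next
    case 2
    \<comment> \<open>Remainder 1 is no generator, so one 4 is traded by
      \<open>4 + 1 = 2 + 3\<close>.\<close>
    with s have "k \<noteq> 0" by auto
    with 2 s that[of 1 1 "k - 1"] show ?thesis by auto
  next
    case 3
    with s that[of 1 0 k] show ?thesis by auto
  next
    case 4
    with s that[of 0 1 k] show ?thesis by auto
  qed
  then have "d = a + b + c + (d - a - b - c) \<and> s = a * 2 + b * 3 + c * 4" by simp
  then show "(d, s) \<in> curve_monoid 3 m"
    unfolding curve_monoid_3 assms by blast
qed

text \<open>With \<open>x\<^sub>i = t\<^bsup>(1,i)\<^esup>\<close> this says \<open>(x\<^sub>i | i \<in> L) : x\<^sub>j = (x\<^sub>i | i \<in> L')\<close> in \<open>K[S]\<close>.\<close>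

definition colon_list :: "(nat \<times> nat) set \<Rightarrow> nat list \<Rightarrow> nat \<Rightarrow> nat list \<Rightarrow> bool"
  where "colon_list S L j L' \<longleftrightarrow> (\<forall>d e. (d, e) \<in> S \<longrightarrow>
    ((\<exists>i\<in>set L. i \<le> e + j \<and> (d, e + j - i) \<in> S) \<longleftrightarrow>
     (\<exists>i\<in>set L'. 1 \<le> d \<and> i \<le> e \<and> (d - 1, e - i) \<in> S)))"

text \<open>Splitting off degree 0, where the condition \<open>1 \<le> d\<close> fails, removes the
  truncated subtraction \<open>d - 1\<close> and prepares the goals for linear arithmetic.\<close>

lemma colon_listI:
  assumes "\<And>e. (0, e) \<in> S \<Longrightarrow> \<not> (\<exists>i\<in>set L. i \<le> e + j \<and> (0, e + j - i) \<in> S)"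
    and "\<And>d e. (Suc d, e) \<in> S \<Longrightarrow> (\<exists>i\<in>set L. i \<le> e + j \<and> (Suc d, e + j - i) \<in> S) \<longleftrightarrow>
      (\<exists>i\<in>set L'. i \<le> e \<and> (d, e - i) \<in> S)"
  shows "colon_list S L j L'"
  unfolding colon_list_def
proof (intro allI impI)
  fix d e assume "(d, e) \<in> S"
  then show "(\<exists>i\<in>set L. i \<le> e + j \<and> (d, e + j - i) \<in> S) \<longleftrightarrow>
     (\<exists>i\<in>set L'. 1 \<le> d \<and> i \<le> e \<and> (d - 1, e - i) \<in> S)"
    using assms by (cases d) auto
qed

context
  fixes m :: "nat \<Rightarrow> nat"
begin

interpretation graded_monoid "curve_monoid 3 m"
  by (rule graded_monoid_curve)

text \<open>A nonzero element of the monoid involves some generator, so a list with all four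
  generates the irrelevant ideal. The colon conditions are those of \<open>monoid_filtration\<close>
  solved for the cofactor.\<close>

lemma koszul_curve_monoidI:
  assumes F: "\<And>L. L \<in> F \<Longrightarrow> \<forall>s<length L. \<exists>L'\<in>F. colon_list (curve_monoid 3 m) (take s L) (L ! s) L'"
    and FS: "\<And>L. L \<in> F \<Longrightarrow> set L \<subseteq> {0, m 1, m 2, m 3}"
    and X: "X \<in> F" "{0, m 1, m 2, m 3} \<subseteq> set X"
  shows "koszul (subset_ring (monoid_algebra (curve_monoid 3 m) :: ((nat \<times> nat) \<Rightarrow>\<^sub>0 'k::field) set)) (monoid_grading (curve_monoid 3 m))"
proof (rule monoid_filtration_koszul)
  let ?S = "curve_monoid 3 m" and ?P = "\<lambda>L. map (Pair (1::nat)) L"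
  show "monoid_filtration (?P ` F)"
    unfolding monoid_filtration_def
  proof (intro ballI conjI allI impI)
    fix M assume "M \<in> ?P ` F"
    then obtain L where L: "L \<in> F" "M = ?P L" by blast
    have "(1, i) \<in> ?S" if "i \<in> set L" for i
      using FS[OF L(1)] that unfolding curve_monoid_3_degree_one by blast
    then show "set M \<subseteq> {a \<in> ?S. fst a = 1}"
      by (auto simp: L)
    fix s assume s: "s < length M"
    then obtain L' where L': "L' \<in> F" "colon_list ?S (take s L) (L ! s) L'"
      using F[OF L(1)] by (auto simp: L)
    have "(\<exists>a\<in>set (take s M). \<exists>t\<in>?S. k + M ! s = a + t) \<longleftrightarrow> (\<exists>a\<in>set (?P L'). \<exists>t\<in>?S. k = a + t)" if "k \<in> ?S" for k
    proof -
      obtain d e where k: "k = (d, e)" by (cases k)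
      have "(\<exists>a\<in>set (take s M). \<exists>t\<in>?S. k + M ! s = a + t) \<longleftrightarrow> (\<exists>i\<in>set (take s L). \<exists>t\<in>?S. (d, e) + (1, L ! s) = (1, i) + t)"
        using s by (simp only: L take_map set_map bex_simps nth_map length_map k)
      moreover have "(\<exists>a\<in>set (?P L'). \<exists>t\<in>?S. k = a + t) \<longleftrightarrow> (\<exists>i\<in>set L'. \<exists>t\<in>?S. (d, e) = (1, i) + t)"
        by (simp only: set_map bex_simps k)
      ultimately show ?thesis
        using L'(2) that unfolding k colon_list_def curve_monoid_step by blast
    qed
    then show "\<exists>L'\<in>?P ` F. \<forall>k\<in>?S. (\<exists>a\<in>set (take s M). \<exists>t\<in>?S. k + M ! s = a + t) \<longleftrightarrow> (\<exists>a\<in>set L'. \<exists>t\<in>?S. k = a + t)"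
      using L'(1) by blast
  qed
  show "?P X \<in> ?P ` F"
    using X(1) by blast
  show "\<exists>a\<in>set (?P X). \<exists>t\<in>?S. k = a + t" if "k \<in> ?S" "k \<noteq> 0" for k
  proof -
    obtain d s where k: "k = (d, s)" by (cases k)
    with \<open>k \<in> ?S\<close> have "(d, s) \<in> ?S" by simp
    then obtain a b c e where abc: "d = a + b + c + e" "s = a * m 1 + b * m 2 + c * m 3"
      unfolding curve_monoid_3 by blast
    have "\<exists>i\<in>{0, m 1, m 2, m 3}. 1 \<le> d \<and> i \<le> s \<and> (d - 1, s - i) \<in> ?S"
    proof -
      have mem: "(a' + b' + c' + e', a' * m 1 + b' * m 2 + c' * m 3) \<in> ?S" for a' b' c' e'
        unfolding curve_monoid_3 by blast
      consider a' where "a = Suc a'" | b' where "b = Suc b'" | c' where "c = Suc c'" | e' where "e = Suc e'"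
        using \<open>k \<noteq> 0\<close> k abc by (cases a; cases b; cases c; cases e) (auto simp: zero_prod_def)
      then show ?thesis
      proof cases
        case 1
        then show ?thesis using mem[of a' b c e] abc by (intro bexI[of _ "m 1"]) (auto simp: algebra_simps)
      next
        case 2
        then show ?thesis using mem[of a b' c e] abc by (intro bexI[of _ "m 2"]) (auto simp: algebra_simps)
      next
        case 3
        then show ?thesis using mem[of a b c' e] abc by (intro bexI[of _ "m 3"]) (auto simp: algebra_simps)
      next
        case 4
        then show ?thesis using mem[of a b c e'] abc by (intro bexI[of _ 0]) auto
      qed
    qed
    then show ?thesis
      using X(2) unfolding k set_map bex_simps curve_monoid_step by blast
  qed
qed

end

text \<open>In terms of the v-exponent \<open>w = 3 * d - e\<close>, the list
  \<open>[0, 1, 2]\<close> generates the monomials with \<open>w > 0\<close>. This is the colon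
  ideal for each nonempty prefix.\<close>

lemma koszul_123:
  assumes m: "m 1 = 1" "m 2 = 2" "m 3 = 3"
  shows "koszul (subset_ring (monoid_algebra (curve_monoid 3 m) :: ((nat \<times> nat) \<Rightarrow>\<^sub>0 'k::field) set)) (monoid_grading (curve_monoid 3 m))"
proof (rule koszul_curve_monoidI)
  let ?S = "curve_monoid 3 m" and ?F = "{[], [0, 1, 2], [0, 1, 2, 3]} :: nat list set"
  have "colon_list ?S [] j []" for j
    by (simp add: colon_list_def)
  moreover have "colon_list ?S [0] 1 [0, 1, 2]"
    by (rule colon_listI; unfold curve_monoid_123[OF m] list.set bex_simps; simp; arith)
  moreover have "colon_list ?S [0, 1] 2 [0, 1, 2]"
    by (rule colon_listI; unfold curve_monoid_123[OF m] list.set bex_simps; simp; arith)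
  moreover have "colon_list ?S [0, 1, 2] 3 [0, 1, 2]"
    by (rule colon_listI; unfold curve_monoid_123[OF m] list.set bex_simps; simp; arith)
  ultimately show "\<forall>s<length L. \<exists>L'\<in>?F. colon_list ?S (take s L) (L ! s) L'" if "L \<in> ?F" for L
    using that by (simp only: insert_iff empty_iff) (elim disjE; simp add: All_less_Suc2)
  show "[0, 1, 2, 3] \<in> ?F" by simp
qed (auto simp: m m[unfolded One_nat_def])

text \<open>The v-exponent \<open>w = 4 * d - e\<close> is never 1, and \<open>[0, 1]\<close> and
  \<open>[0, 1, 2]\<close> generate the monomials with \<open>w \<ge> 3\<close> and
  \<open>w \<ge> 2\<close>. For example, multiplying by the variable 1 and dividing by the variable
  0 lowers \<open>w\<close> by one, which is possible exactly for \<open>w \<ge> 3\<close>.\<close>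

lemma koszul_124:
  assumes m: "m 1 = 1" "m 2 = 2" "m 3 = 4"
  shows "koszul (subset_ring (monoid_algebra (curve_monoid 3 m) :: ((nat \<times> nat) \<Rightarrow>\<^sub>0 'k::field) set)) (monoid_grading (curve_monoid 3 m))"
proof (rule koszul_curve_monoidI)
  let ?S = "curve_monoid 3 m" and ?F = "{[], [0, 1], [0, 1, 2], [0, 1, 2, 4]} :: nat list set"
  have "colon_list ?S [] j []" for j
    by (simp add: colon_list_def)
  moreover have "colon_list ?S [0] 1 [0, 1]"
    by (rule colon_listI; unfold curve_monoid_124[OF m] list.set bex_simps; simp; arith)
  moreover have "colon_list ?S [0, 1] 2 [0, 1, 2]"
    by (rule colon_listI; unfold curve_monoid_124[OF m] list.set bex_simps; simp; arith)
  moreover have "colon_list ?S [0, 1, 2] 4 [0, 1, 2]"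
    by (rule colon_listI; unfold curve_monoid_124[OF m] list.set bex_simps; simp; arith)
  ultimately show "\<forall>s<length L. \<exists>L'\<in>?F. colon_list ?S (take s L) (L ! s) L'" if "L \<in> ?F" for L
    using that by (simp only: insert_iff empty_iff) (elim disjE; simp add: All_less_Suc2)
  show "[0, 1, 2, 4] \<in> ?F" by simp
qed (auto simp: m m[unfolded One_nat_def])

text \<open>The lists are those for 1, 2, 4 under the reflection that replaces \<open>i\<close> by
  \<open>4 - i\<close>; the u-exponent \<open>e\<close> takes over the part of the
  v-exponent.\<close>

lemma koszul_234:
  assumes m: "m 1 = 2" "m 2 = 3" "m 3 = 4"
  shows "koszul (subset_ring (monoid_algebra (curve_monoid 3 m) :: ((nat \<times> nat) \<Rightarrow>\<^sub>0 'k::field) set)) (monoid_grading (curve_monoid 3 m))"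
proof (rule koszul_curve_monoidI)
  let ?S = "curve_monoid 3 m" and ?F = "{[], [4, 3], [4, 3, 2], [4, 3, 2, 0]} :: nat list set"
  have "colon_list ?S [] j []" for j
    by (simp add: colon_list_def)
  moreover have "colon_list ?S [4] 3 [4, 3]"
    by (rule colon_listI; unfold curve_monoid_234[OF m] list.set bex_simps; simp; arith)
  moreover have "colon_list ?S [4, 3] 2 [4, 3, 2]"
    by (rule colon_listI; unfold curve_monoid_234[OF m] list.set bex_simps; simp; arith)
  moreover have "colon_list ?S [4, 3, 2] 0 [4, 3, 2]"
    by (rule colon_listI; unfold curve_monoid_234[OF m] list.set bex_simps; simp; arith)
  ultimately show "\<forall>s<length L. \<exists>L'\<in>?F. colon_list ?S (take s L) (L ! s) L'" if "L \<in> ?F" for L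
    using that by (simp only: insert_iff empty_iff) (elim disjE; simp add: All_less_Suc2)
  show "[4, 3, 2, 0] \<in> ?F" by simp
qed (auto simp: m m[unfolded One_nat_def])

theorem theorem4p3:
  fixes m :: "nat \<Rightarrow> nat"
  assumes "infinite (UNIV :: 'k::field set)"
    and "0 < m 1" and "m 1 < m 2" and "m 2 < m 3"
    and "Gcd {m 1, m 2, m 3} = 1"
  shows "koszul (curve_ring 3 m :: 'k mpoly set ring) (curve_grading 3 m) \<longleftrightarrow>
    {m 1, m 2, m 3} \<in> {{1, 2, 3}, {1, 2, 4}, {2, 3, 4}}"
proof -
  note m = assms(2-4)
  let ?A = "subset_ring (monoid_algebra (curve_monoid 3 m) :: ((nat \<times> nat) \<Rightarrow>\<^sub>0 'k) set)"
  have "m i \<le> m 3" if "i \<in> {1..3}" for i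
  proof -
    from that consider "i = 1" | "i = 2" | "i = 3" by fastforce
    then show ?thesis using m by cases auto
  qed
  then have "koszul (curve_ring 3 m :: 'k mpoly set ring) (curve_grading 3 m) \<longleftrightarrow> koszul ?A (monoid_grading (curve_monoid 3 m))"
    using m by (intro koszul_curve_iff) auto
  also have "\<dots> \<longleftrightarrow> {m 1, m 2, m 3} \<in> {{1, 2, 3}, {1, 2, 4}, {2, 3, 4}}"
  proof
    assume k: "koszul ?A (monoid_grading (curve_monoid 3 m))"
    have gcd: "x = 1" if "x dvd m 1" "x dvd m 2" "x dvd m 3" for x
    proof -
      have "x dvd Gcd {m 1, m 2, m 3}"
        by (rule Gcd_greatest) (use that in auto)
      then show ?thesis
        unfolding assms(5) by simp
    qed
    \<comment> \<open>Neither summand is \<open>m 1\<close>, and two larger exponents exceed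
      \<open>2 * m 1\<close>, so one summand is 0.\<close>
    have "m 2 = 2 * m 1 \<or> m 3 = 2 * m 1"
      using koszul_double[OF m k, of "m 1" "m 2"] m by auto
    \<comment> \<open>Here \<open>m 3\<close> is the only exponent above \<open>m 2\<close>, so it
      must be a summand; its partner is 0 or \<open>m 1\<close>.\<close>
    moreover have "m 3 = 2 * m 2 \<or> m 1 + m 3 = 2 * m 2"
      using koszul_double[OF m k, of "m 2" "m 3"] m by auto
    \<comment> \<open>The fourth combination \<open>m 3 = 2 * m 1 = 2 * m 2\<close> contradicts
      \<open>m 1 < m 2\<close>.\<close>
    ultimately consider "m 2 = 2 * m 1" "m 3 = 4 * m 1" | "m 2 = 2 * m 1" "m 3 = 3 * m 1"
      | "m 3 = 2 * m 1" "3 * m 1 = 2 * m 2"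
      using m by linarith
    then show "{m 1, m 2, m 3} \<in> {{1, 2, 3}, {1, 2, 4}, {2, 3, 4}}"
    proof cases
      case 3
      \<comment> \<open>By \<open>3 * m 1 = 2 * m 2\<close> the difference is half of
        \<open>m 1\<close>; it divides all three exponents and is therefore 1.\<close>
      define t where "t = m 2 - m 1"
      have "m 1 = 2 * t" "m 2 = 3 * t" "m 3 = 4 * t"
        using 3 by (auto simp: t_def)
      with gcd[of t] show ?thesis by simp
    qed (use gcd[of "m 1"] in auto)
  next
    assume "{m 1, m 2, m 3} \<in> {{1, 2, 3}, {1, 2, 4}, {2, 3, 4}}"
    \<comment> \<open>Strictly increasing lists with the same elements coincide, which identifies
      the \<open>m i\<close> one by one.\<close>
    moreover have "[m 1, m 2, m 3] = [x, y, z]" if "{m 1, m 2, m 3} = {x, y, z}" "x < y" "y < z" for x y z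
      using m that by (intro sorted_distinct_set_unique) auto
    ultimately consider "m 1 = 1 \<and> m 2 = 2 \<and> m 3 = 3" | "m 1 = 1 \<and> m 2 = 2 \<and> m 3 = 4" | "m 1 = 2 \<and> m 2 = 3 \<and> m 3 = 4"
      by fastforce
    then show "koszul ?A (monoid_grading (curve_monoid 3 m))"
      by cases (auto intro: koszul_123 koszul_124 koszul_234)
  qed
  finally show ?thesis .
qed

end
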